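(* Let $n\geq 2$. The ring \[B^{(n)}:=\mathbb{Z}[{}^nb_1,\ldots,{}^nb_{n-1},{}^nb_n,{}^nb'_n,{}^nb_{n+1},\ldots]\] of eta polynomials of level $n$ is equal to the subring $\Gamma'[X_n]^{\widetilde{W}_n}$ of $\widetilde{W}_n$-invariants in $\Gamma'[X_n]$.
   Context: $b_1,b_2,\ldots$ are commuting variables, $b_0:=1$, $b_p:=0$ for $p<0$; $\Gamma'$ is the quotient of $\mathbb{Z}[b_1,b_2,\ldots]$ by the relations $b_p^2+2\sum_{i=1}^{p-1}(-1)^ib_{p+i}b_{p-i}+(-1)^pb_{2p}=0$ for all $p\geq1$. Put $c_p:=2b_p$ for $p\geq1$ and $c_0:=1$. $X_n=(x_1,\ldots,x_n)$ are independent variables and $e_j(X_n)$ the elementary symmetric polynomials. For $p\geq1$, \[{}^nb_p:=\begin{cases}e_p(X_n)+2\sum_{j=0}^{p-1}b_{p-j}e_j(X_n)&\text{if }p<n,\\ \sum_{j=0}^pb_{p-j}e_j(X_n)&\text{if }p\geq n,\end{cases}\qquad {}^nb'_n:=\sum_{j=0}^{n-1}b_{n-j}e_j(X_n).\] $\widetilde{W}_n$ is the group of signed permutations of $\{1,\ldots,n\}$ with an even number of sign changes, generated by $s_i=(i,i+1)$, $1\leq i\leq n-1$, and $s_\Box$, where $(w_1,w_2,w_3,\ldots,w_n)s_\Box=(-w_2,-w_1,w_3,\ldots,w_n)$. It acts on $\Gamma'[X_n]$ by ring automorphisms: $s_i$ ($i\geq1$) interchanges $x_i,x_{i+1}$ and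 fixes the other $x_j$ and all $b_p$; $s_\Box$ sends $(x_1,x_2)\mapsto(-x_2,-x_1)$, fixes $x_j$ for $j\geq3$, and $s_\Box(b_p)=b_p+(x_1+x_2)\sum_{j=0}^{p-1}\big(\sum_{a+b=j}x_1^ax_2^b\big)c_{p-1-j}$ for $p\geq1$. *)

theory Defs
  imports
    "HOL-Library.Poly_Mapping"
    "HOL-Combinatorics.Permutations"
    "HOL-Computational_Algebra.Formal_Power_Series"
begin

section \<open>Polynomials in variables indexed by the natural numbers\<close>

type_synonym 'a mpoly = "(nat \<Rightarrow>\<^sub>0 nat) \<Rightarrow>\<^sub>0 'a"

definition Const :: "'a::zero \<Rightarrow> 'a mpoly" where
  "Const a = Poly_Mapping.single 0 a"

definition Var :: "nat \<Rightarrow> 'a::zero_neq_one mpoly" where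
  "Var i = Poly_Mapping.single (Poly_Mapping.single i 1) 1"

definition mon_eval :: "(nat \<Rightarrow> 'b::comm_ring_1) \<Rightarrow> (nat \<Rightarrow>\<^sub>0 nat) \<Rightarrow> 'b" where
  "mon_eval v m = (\<Prod>i\<in>Poly_Mapping.keys m. v i ^ Poly_Mapping.lookup m i)"

text \<open>The homomorphism that is \<open>h\<close> on coefficients and sends the \<open>i\<close>-th variable to \<open>v i\<close>.\<close>

definition mpoly_eval :: "('a::comm_ring_1 \<Rightarrow> 'b::comm_ring_1) \<Rightarrow> (nat \<Rightarrow> 'b) \<Rightarrow> 'a mpoly \<Rightarrow> 'b" where
  "mpoly_eval h v f = (\<Sum>m\<in>Poly_Mapping.keys f. h (Poly_Mapping.lookup f m) * mon_eval v m)"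

definition is_ring_hom :: "('a::comm_ring_1 \<Rightarrow> 'b::comm_ring_1) \<Rightarrow> bool" where
  "is_ring_hom h \<longleftrightarrow> h 1 = 1 \<and> (\<forall>x y. h (x + y) = h x + h y) \<and> (\<forall>x y. h (x * y) = h x * h y)"

lemma ring_homD:
  assumes "is_ring_hom h"
  shows "h 0 = 0" "h 1 = 1" "h (x + y) = h x + h y" "h (x * y) = h x * h y"
    "h (- x) = - h x" "h (x - y) = h x - h y" "h (x ^ k) = h x ^ k"
    "h (sum g A) = (\<Sum>a\<in>A. h (g a))" "h (prod g A) = (\<Prod>a\<in>A. h (g a))"
    "h (of_nat k) = of_nat k" "h (of_int z) = of_int z" "h (numeral w) = numeral w"
proof -
  have one: "h 1 = 1" and add: "\<And>x y. h (x + y) = h x + h y"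
    and mult: "\<And>x y. h (x * y) = h x * h y"
    using assms by (auto simp: is_ring_hom_def)
  interpret additive h by standard (rule add)
  show "h 0 = 0" "h 1 = 1" "h (x + y) = h x + h y" "h (x * y) = h x * h y"
    "h (- x) = - h x" "h (x - y) = h x - h y"
    by (simp_all add: one add mult zero minus diff)
  show "h (x ^ k) = h x ^ k" by (induction k) (simp_all add: one mult)
  show "h (sum g A) = (\<Sum>a\<in>A. h (g a))" by (rule sum)
  show "h (prod g A) = (\<Prod>a\<in>A. h (g a))"
    by (induction A rule: infinite_finite_induct) (simp_all add: one mult)
  have nat: "h (of_nat k) = of_nat k" for k by (induction k) (simp_all add: one add zero)
  show "h (of_nat k) = of_nat k" by (rule nat)
  show "h (of_int z) = of_int z" by (cases z rule: int_diff_cases) (simp add: diff nat)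
  show "h (numeral w) = numeral w" using nat[of "numeral w"] by simp
qed

lemma ring_hom_comp: "is_ring_hom g \<Longrightarrow> is_ring_hom h \<Longrightarrow> is_ring_hom (g \<circ> h)"
  by (simp add: is_ring_hom_def)

lemma is_ring_hom_id: "is_ring_hom id"
  by (simp add: is_ring_hom_def)

lemma is_ring_hom_of_int: "is_ring_hom of_int"
  by (simp add: is_ring_hom_def)

lemma is_ring_hom_Const: "is_ring_hom Const"
  by (simp add: is_ring_hom_def Const_def single_add mult_single)

lemma mon_eval_superset:
  assumes "finite A" "Poly_Mapping.keys m \<subseteq> A"
  shows "mon_eval v m = (\<Prod>i\<in>A. v i ^ Poly_Mapping.lookup m i)"
  unfolding mon_eval_def
  by (rule prod.mono_neutral_left) (use assms in \<open>auto simp: in_keys_iff\<close>)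

lemma mon_eval_zero: "mon_eval v 0 = 1"
  by (simp add: mon_eval_def)

lemma mon_eval_add: "mon_eval v (m + m') = mon_eval v m * mon_eval v m'"
proof -
  let ?A = "Poly_Mapping.keys m \<union> Poly_Mapping.keys m'"
  have "mon_eval v (m + m') = (\<Prod>i\<in>?A. v i ^ Poly_Mapping.lookup (m + m') i)"
    using keys_add[of m m'] by (intro mon_eval_superset) auto
  also have "\<dots> = (\<Prod>i\<in>?A. v i ^ Poly_Mapping.lookup m i) * (\<Prod>i\<in>?A. v i ^ Poly_Mapping.lookup m' i)"
    by (simp add: lookup_add power_add prod.distrib)
  also have "\<dots> = mon_eval v m * mon_eval v m'"
    by (simp add: mon_eval_superset[symmetric])
  finally show ?thesis .
qed

lemma mpoly_eval_single:
  assumes "is_ring_hom h"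
  shows "mpoly_eval h v (Poly_Mapping.single m a) = h a * mon_eval v m"
  by (cases "a = 0") (simp_all add: mpoly_eval_def ring_homD[OF assms])

lemma mpoly_eval_superset:
  assumes "is_ring_hom h" "finite A" "Poly_Mapping.keys f \<subseteq> A"
  shows "mpoly_eval h v f = (\<Sum>m\<in>A. h (Poly_Mapping.lookup f m) * mon_eval v m)"
  unfolding mpoly_eval_def
  by (rule sum.mono_neutral_left) (use assms in \<open>auto simp: in_keys_iff ring_homD\<close>)

lemma mpoly_eval_add:
  assumes "is_ring_hom h"
  shows "mpoly_eval h v (f + g) = mpoly_eval h v f + mpoly_eval h v g"
proof -
  let ?A = "Poly_Mapping.keys f \<union> Poly_Mapping.keys g"
  have "mpoly_eval h v (f + g) = (\<Sum>m\<in>?A. h (Poly_Mapping.lookup (f + g) m) * mon_eval v m)"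
    using keys_add[of f g] by (intro mpoly_eval_superset[OF assms]) auto
  also have "\<dots> = (\<Sum>m\<in>?A. h (Poly_Mapping.lookup f m) * mon_eval v m)
      + (\<Sum>m\<in>?A. h (Poly_Mapping.lookup g m) * mon_eval v m)"
    by (simp add: lookup_add ring_homD[OF assms] distrib_right sum.distrib)
  also have "\<dots> = mpoly_eval h v f + mpoly_eval h v g"
    by (simp add: mpoly_eval_superset[OF assms, symmetric])
  finally show ?thesis .
qed

lemma mpoly_eval_sum:
  assumes "is_ring_hom h"
  shows "mpoly_eval h v (sum F A) = (\<Sum>a\<in>A. mpoly_eval h v (F a))"
proof -
  interpret additive "mpoly_eval h v" by standard (rule mpoly_eval_add[OF assms])
  show ?thesis by (rule sum)
qed

lemma mpoly_sum_monomials: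
  "f = (\<Sum>m\<in>Poly_Mapping.keys f. Poly_Mapping.single m (Poly_Mapping.lookup f m))"
proof (rule poly_mapping_eqI)
  fix k
  have "Poly_Mapping.lookup (\<Sum>m\<in>Poly_Mapping.keys f. Poly_Mapping.single m (Poly_Mapping.lookup f m)) k
      = (\<Sum>m\<in>Poly_Mapping.keys f. if m = k then Poly_Mapping.lookup f m else 0)"
    by (simp add: lookup_sum lookup_single when_def)
  also have "\<dots> = Poly_Mapping.lookup f k"
    by (simp add: sum.delta in_keys_iff)
  finally show "Poly_Mapping.lookup f k
      = Poly_Mapping.lookup (\<Sum>m\<in>Poly_Mapping.keys f. Poly_Mapping.single m (Poly_Mapping.lookup f m)) k"
    by simp
qed

lemma mpoly_eval_mult:
  assumes "is_ring_hom h"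
  shows "mpoly_eval h v (f * g) = mpoly_eval h v f * mpoly_eval h v g"
proof -
  let ?s = "\<lambda>f m. Poly_Mapping.single m (Poly_Mapping.lookup f m)"
  have "f * g = (\<Sum>m\<in>Poly_Mapping.keys f. ?s f m) * (\<Sum>m\<in>Poly_Mapping.keys g. ?s g m)"
    using mpoly_sum_monomials[of f] mpoly_sum_monomials[of g] by simp
  also have "\<dots> = (\<Sum>m\<in>Poly_Mapping.keys f. \<Sum>m'\<in>Poly_Mapping.keys g. ?s f m * ?s g m')"
    by (simp add: sum_product)
  finally have "mpoly_eval h v (f * g)
      = (\<Sum>m\<in>Poly_Mapping.keys f. \<Sum>m'\<in>Poly_Mapping.keys g. mpoly_eval h v (?s f m * ?s g m'))"
    by (simp add: mpoly_eval_sum[OF assms])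
  also have "\<dots> = mpoly_eval h v f * mpoly_eval h v g"
    unfolding mult_single mpoly_eval_single[OF assms] mon_eval_add ring_homD(4)[OF assms]
    unfolding mpoly_eval_def sum_product by (simp add: mult_ac)
  finally show ?thesis .
qed

lemma is_ring_hom_mpoly_eval:
  assumes "is_ring_hom h"
  shows "is_ring_hom (mpoly_eval h v)"
proof -
  have "mpoly_eval h v 1 = 1"
    using mpoly_eval_single[OF assms, of v 0 1] by (simp add: ring_homD[OF assms] mon_eval_zero)
  then show ?thesis
    using mpoly_eval_add[OF assms] mpoly_eval_mult[OF assms] by (simp add: is_ring_hom_def)
qed

lemma mpoly_eval_Const: "is_ring_hom h \<Longrightarrow> mpoly_eval h v (Const a) = h a"
  by (simp add: Const_def mpoly_eval_single mon_eval_zero)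

lemma mpoly_eval_Var: "is_ring_hom h \<Longrightarrow> mpoly_eval h v (Var i) = v i"
  by (simp add: Var_def mpoly_eval_single mon_eval_def ring_homD)

lemma ring_hom_mon_eval:
  assumes "is_ring_hom g"
  shows "g (mon_eval v m) = mon_eval (\<lambda>i. g (v i)) m"
  by (simp add: mon_eval_def ring_homD[OF assms])

lemma ring_hom_mpoly_eval:
  assumes "is_ring_hom g"
  shows "g (mpoly_eval h v f) = mpoly_eval (\<lambda>a. g (h a)) (\<lambda>i. g (v i)) f"
  by (simp add: mpoly_eval_def ring_homD[OF assms] ring_hom_mon_eval[OF assms])


section \<open>The ring \<open>\<Gamma>'\<close>\<close>

text \<open>The left-hand side of the \<open>p\<close>-th relation, for \<open>p \<ge> 1\<close>.\<close>

definition b_relation :: "(nat \<Rightarrow> 'a::comm_ring_1) \<Rightarrow> nat \<Rightarrow> 'a" where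
  "b_relation b p = b p ^ 2 + 2 * (\<Sum>i=1..p-1. (-1) ^ i * b (p + i) * b (p - i)) + (-1) ^ p * b (2 * p)"

lemma ring_hom_b_relation:
  assumes "is_ring_hom g"
  shows "g (b_relation b p) = b_relation (\<lambda>i. g (b i)) p"
  by (simp add: b_relation_def ring_homD[OF assms])

lemma b_relation_cong:
  assumes "\<And>i. i \<ge> 1 \<Longrightarrow> b i = b' i" "p \<ge> 1"
  shows "b_relation b p = b_relation b' p"
proof -
  have "(\<Sum>i=1..p-1. (-1) ^ i * b (p + i) * b (p - i)) = (\<Sum>i=1..p-1. (-1) ^ i * b' (p + i) * b' (p - i))"
  proof (rule sum.cong)
    fix i assume "i \<in> {1..p-1}"
    then have "b (p + i) = b' (p + i)" "b (p - i) = b' (p - i)"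
      using assms(2) by (auto intro!: assms(1))
    then show "(-1) ^ i * b (p + i) * b (p - i) = (-1) ^ i * b' (p + i) * b' (p - i)" by simp
  qed simp
  then show ?thesis using assms by (simp add: b_relation_def)
qed

text \<open>In \<open>\<int>[b\<^sub>1, b\<^sub>2, \<dots>]\<close> the variable \<open>b\<^sub>p\<close> is \<open>Var (p - 1)\<close>, so that no variable is left over.\<close>

definition free_b :: "nat \<Rightarrow> int mpoly" where
  "free_b p = (if p = 0 then 1 else Var (p - 1))"

definition b_ideal :: "int mpoly set" where
  "b_ideal = module.span (*) (b_relation free_b ` {1..})"

lemma module_times: "module ((*) :: 'a::comm_ring_1 \<Rightarrow> 'a \<Rightarrow> 'a)"
  by unfold_locales (simp_all add: algebra_simps)

lemma b_ideal_props:
  "0 \<in> b_ideal" "x \<in> b_ideal \<Longrightarrow> y \<in> b_ideal \<Longrightarrow> x + y \<in> b_ideal"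
  "x \<in> b_ideal \<Longrightarrow> y \<in> b_ideal \<Longrightarrow> x - y \<in> b_ideal"
  "x \<in> b_ideal \<Longrightarrow> - x \<in> b_ideal" "x \<in> b_ideal \<Longrightarrow> y * x \<in> b_ideal"
  "p \<ge> 1 \<Longrightarrow> b_relation free_b p \<in> b_ideal"
  by (auto simp: b_ideal_def intro: module.span_zero[OF module_times] module.span_add[OF module_times]
      module.span_diff[OF module_times] module.span_neg[OF module_times]
      module.span_scale[OF module_times] module.span_base[OF module_times])

lemma b_ideal_eqI: "x = y \<Longrightarrow> x - y \<in> b_ideal"
  by (simp add: b_ideal_props(1))

lemma ring_hom_b_ideal:
  assumes "is_ring_hom g" "\<And>p. p \<ge> 1 \<Longrightarrow> g (b_relation free_b p) = 0" "x \<in> b_ideal"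
  shows "g x = 0"
  using assms(3) unfolding b_ideal_def
  by (induction rule: module.span_induct_alt[OF module_times, consumes 1])
    (use assms(2) in \<open>auto simp: ring_homD[OF assms(1)]\<close>)

lemma one_not_in_b_ideal: "1 \<notin> b_ideal"
proof
  let ?e = "mpoly_eval id (\<lambda>_. 0) :: int mpoly \<Rightarrow> int"
  have hom: "is_ring_hom ?e" by (intro is_ring_hom_mpoly_eval is_ring_hom_id)
  have b: "?e (free_b i) = (if i = 0 then 1 else 0)" for i
    by (simp add: free_b_def mpoly_eval_Var is_ring_hom_id ring_homD[OF hom])
  have rel: "?e (b_relation free_b p) = 0" if "p \<ge> 1" for p
  proof -
    have "?e (b_relation free_b p) = b_relation (\<lambda>i. ?e (free_b i)) p"
      by (rule ring_hom_b_relation[OF hom])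
    also have "\<dots> = b_relation (\<lambda>_. 0) p" using that by (intro b_relation_cong) (auto simp: b)
    also have "\<dots> = 0" by (simp add: b_relation_def)
    finally show ?thesis .
  qed
  assume "1 \<in> b_ideal"
  from ring_hom_b_ideal[OF hom rel this] ring_homD(2)[OF hom] show False
    by (metis zero_neq_one)
qed

quotient_type gamma = "int mpoly" / "\<lambda>p q. p - q \<in> b_ideal"
proof (rule equivpI)
  show "reflp (\<lambda>p q. p - q \<in> b_ideal)" by (simp add: reflp_def b_ideal_props)
  show "symp (\<lambda>p q. p - q \<in> b_ideal)"
  proof (rule sympI)
    fix p q :: "int mpoly"
    assume "p - q \<in> b_ideal"
    from b_ideal_props(4)[OF this] show "q - p \<in> b_ideal" by simp
  qed
  show "transp (\<lambda>p q. p - q \<in> b_ideal)"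
  proof (rule transpI)
    fix p q r :: "int mpoly"
    assume "p - q \<in> b_ideal" "q - r \<in> b_ideal"
    from b_ideal_props(2)[OF this] show "p - r \<in> b_ideal" by simp
  qed
qed

instantiation gamma :: comm_ring_1
begin

lift_definition zero_gamma :: gamma is 0 .
lift_definition one_gamma :: gamma is 1 .

lift_definition plus_gamma :: "gamma \<Rightarrow> gamma \<Rightarrow> gamma" is "(+)"
proof -
  fix p p' q q' :: "int mpoly"
  assume "p - p' \<in> b_ideal" "q - q' \<in> b_ideal"
  from b_ideal_props(2)[OF this] show "p + q - (p' + q') \<in> b_ideal" by (simp add: algebra_simps)
qed

lift_definition minus_gamma :: "gamma \<Rightarrow> gamma \<Rightarrow> gamma" is "(-)"
proof -
  fix p p' q q' :: "int mpoly"
  assume "p - p' \<in> b_ideal" "q - q' \<in> b_ideal"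
  moreover have "p - q - (p' - q') = (p - p') - (q - q')" by simp
  ultimately show "p - q - (p' - q') \<in> b_ideal" using b_ideal_props(3) by metis
qed

lift_definition uminus_gamma :: "gamma \<Rightarrow> gamma" is "uminus"
proof -
  fix p q :: "int mpoly"
  assume "p - q \<in> b_ideal"
  from b_ideal_props(4)[OF this] show "- p - - q \<in> b_ideal" by simp
qed

lift_definition times_gamma :: "gamma \<Rightarrow> gamma \<Rightarrow> gamma" is "(*)"
proof -
  fix p p' q q' :: "int mpoly"
  assume "p - p' \<in> b_ideal" "q - q' \<in> b_ideal"
  moreover have "p * q - p' * q' = q * (p - p') + p' * (q - q')" by (simp add: algebra_simps)
  ultimately show "p * q - p' * q' \<in> b_ideal" using b_ideal_props(2,5) by metis
qed

instance
proof
  show "(0::gamma) \<noteq> 1"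
  proof transfer
    show "(0 :: int mpoly) - 1 \<notin> b_ideal"
      using one_not_in_b_ideal b_ideal_props(4)[of "0 - 1"] by auto
  qed
qed (transfer, rule b_ideal_eqI, simp add: algebra_simps)+

end

lemma is_ring_hom_abs_gamma: "is_ring_hom abs_gamma"
  by (simp add: is_ring_hom_def one_gamma.abs_eq plus_gamma.abs_eq times_gamma.abs_eq)

lift_definition gamma_b :: "nat \<Rightarrow> gamma" is free_b .

text \<open>The series \<open>c\<^sub>0 = 1\<close>, \<open>c\<^sub>p = 2 b\<^sub>p\<close> attached to a sequence \<open>b\<close> in any ring.\<close>

definition c_of :: "(nat \<Rightarrow> 'a::comm_ring_1) \<Rightarrow> nat \<Rightarrow> 'a" where
  "c_of b p = (if p = 0 then 1 else 2 * b p)"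


section \<open>The action on \<open>\<Gamma>'[X\<^sub>n]\<close>\<close>

definition poly_X :: "nat \<Rightarrow> gamma mpoly set" where
  "poly_X n = {f. \<forall>m \<in> Poly_Mapping.keys f. Poly_Mapping.keys m \<subseteq> {1..n}}"

definition s_act :: "nat \<Rightarrow> gamma mpoly \<Rightarrow> gamma mpoly" where
  "s_act i = mpoly_eval Const (\<lambda>j. Var (transpose i (i + 1) j))"

text \<open>The value of \<open>s\<^sub>\<box>\<close> on \<open>b\<^sub>p\<close>, with \<open>x\<close> and \<open>y\<close> for \<open>x\<^sub>1\<close> and \<open>x\<^sub>2\<close>.\<close>

definition box_b :: "(nat \<Rightarrow> 'a::comm_ring_1) \<Rightarrow> 'a \<Rightarrow> 'a \<Rightarrow> nat \<Rightarrow> 'a" where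
  "box_b b x y p = b p + (x + y) * (\<Sum>j<p. (\<Sum>a\<le>j. x ^ a * y ^ (j - a)) * c_of b (p - 1 - j))"

lemma ring_hom_box_b:
  assumes "is_ring_hom g"
  shows "g (box_b b x y p) = box_b (\<lambda>i. g (b i)) (g x) (g y) p"
proof -
  have "g (c_of b i) = c_of (\<lambda>i. g (b i)) i" for i
    by (simp add: c_of_def ring_homD[OF assms])
  then show ?thesis by (simp add: box_b_def ring_homD[OF assms])
qed

text \<open>
  That \<open>s\<^sub>\<box>\<close> respects the relations is seen over \<open>\<int>\<close>, where one may divide by 4: with
  \<open>C(t) = \<Sum> c\<^sub>p t\<^sup>p\<close> the relations are the coefficients of \<open>C(t) C(-t) = 1\<close> divided by 4, and
  \<open>s\<^sub>\<box>\<close> multiplies \<open>C(t)\<close> by \<open>(1 + x\<^sub>1 t)(1 + x\<^sub>2 t) / ((1 - x\<^sub>1 t)(1 - x\<^sub>2 t))\<close>.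
\<close>

definition fps_neg_arg :: "'a::comm_ring_1 fps \<Rightarrow> 'a fps" where
  "fps_neg_arg f = Abs_fps (\<lambda>n. (-1) ^ n * fps_nth f n)"

lemma fps_neg_arg_mult: "fps_neg_arg (f * g) = fps_neg_arg f * fps_neg_arg g"
proof (rule fps_ext)
  fix n
  have "(-1) ^ n * (fps_nth f i * fps_nth g (n - i))
      = (-1) ^ i * fps_nth f i * ((-1) ^ (n - i) * fps_nth g (n - i))" if "i \<le> n" for i
  proof -
    have "(-1) ^ n = (-1) ^ i * (-1 :: 'a) ^ (n - i)" using that by (simp flip: power_add)
    then show ?thesis by (simp add: mult_ac)
  qed
  then show "fps_nth (fps_neg_arg (f * g)) n = fps_nth (fps_neg_arg f * fps_neg_arg g) n"
    by (simp add: fps_neg_arg_def fps_mult_nth sum_distrib_left)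
qed

lemma fps_neg_arg_one: "fps_neg_arg 1 = 1"
  by (rule fps_ext) (simp add: fps_neg_arg_def)

lemma fps_neg_arg_lin: "fps_neg_arg (1 + fps_const x * fps_X) = 1 + fps_const (- x) * fps_X"
  by (rule fps_ext) (simp add: fps_neg_arg_def fps_X_def)

lemma fps_geometric: "(1 + fps_const (- x) * fps_X) * Abs_fps (\<lambda>n. x ^ n) = (1 :: 'a::comm_ring_1 fps)"
proof (rule fps_ext)
  fix n
  have "(1 + fps_const (- x) * fps_X) * Abs_fps (\<lambda>n. x ^ n)
      = Abs_fps (\<lambda>n. x ^ n) - fps_const x * (fps_X * Abs_fps (\<lambda>n. x ^ n))"
    by (simp add: algebra_simps flip: fps_const_neg)
  then show "fps_nth ((1 + fps_const (- x) * fps_X) * Abs_fps (\<lambda>n. x ^ n)) n = fps_nth 1 n"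
    by (cases n) simp_all
qed

lemma sum_about_middle:
  fixes f :: "nat \<Rightarrow> 'a::comm_monoid_add"
  shows "(\<Sum>j=0..2*p. f j) = f p + (\<Sum>i=1..p. f (p + i) + f (p - i))"
proof -
  have "{0..2*p} = {0..<p} \<union> ({p} \<union> {p+1..2*p})" by auto
  then have "(\<Sum>j=0..2*p. f j) = sum f {0..<p} + (f p + sum f {p+1..2*p})"
    by (simp only:) (subst sum.union_disjoint; auto)+
  moreover have "sum f {0..<p} = (\<Sum>i=1..p. f (p - i))"
    by (rule sum.reindex_bij_witness[of _ "\<lambda>i. p - i" "\<lambda>i. p - i"]) auto
  moreover have "sum f {p+1..2*p} = (\<Sum>i=1..p. f (p + i))"
    by (rule sum.reindex_bij_witness[of _ "\<lambda>i. p + i" "\<lambda>i. i - p"]) auto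
  ultimately show ?thesis by (simp add: sum.distrib ac_simps)
qed

lemma c_series_coeff:
  assumes "p \<ge> 1"
  shows "fps_nth (Abs_fps (c_of b) * fps_neg_arg (Abs_fps (c_of b))) (2 * p)
    = 4 * (-1) ^ p * b_relation b p"
proof -
  let ?c = "c_of b"
  let ?f = "\<lambda>j. ?c j * ((-1) ^ (2 * p - j) * ?c (2 * p - j))"
  have pow: "(-1) ^ (p - i) = (-1) ^ p * (-1 :: 'a) ^ i" if "i \<le> p" for i
  proof -
    have "(-1) ^ p = (-1 :: 'a) ^ (p - i) * (-1) ^ i" using that by (simp flip: power_add)
    then show ?thesis by (simp add: mult.assoc minus_one_mult_self)
  qed
  have pair: "?f (p + i) + ?f (p - i) = 2 * ((-1) ^ p * (-1) ^ i * ?c (p + i) * ?c (p - i))"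
    if "i \<le> p" for i
  proof -
    have "2 * p - (p + i) = p - i" "2 * p - (p - i) = p + i" using that by auto
    then show ?thesis by (simp only: pow[OF that] power_add mult_2 mult_ac)
  qed
  have split: "{1..p} = insert p {1..p-1}" using assms by auto
  have "fps_nth (Abs_fps ?c * fps_neg_arg (Abs_fps ?c)) (2 * p) = (\<Sum>j=0..2*p. ?f j)"
    by (simp add: fps_mult_nth fps_neg_arg_def)
  also have "\<dots> = ?f p + (\<Sum>i=1..p. ?f (p + i) + ?f (p - i))" by (rule sum_about_middle)
  also have "(\<Sum>i=1..p. ?f (p + i) + ?f (p - i))
      = (\<Sum>i=1..p. 2 * ((-1) ^ p * (-1) ^ i * ?c (p + i) * ?c (p - i)))"
    by (intro sum.cong pair) auto
  also have "\<dots> = 2 * ?c (2 * p) + (\<Sum>i=1..p-1. 2 * ((-1) ^ p * (-1) ^ i * ?c (p + i) * ?c (p - i)))"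
  proof -
    have "p \<notin> {1..p-1}" using assms by auto
    then have "(\<Sum>i=1..p. 2 * ((-1) ^ p * (-1) ^ i * ?c (p + i) * ?c (p - i)))
        = 2 * ((-1) ^ p * (-1) ^ p * ?c (p + p) * ?c (p - p))
          + (\<Sum>i=1..p-1. 2 * ((-1) ^ p * (-1) ^ i * ?c (p + i) * ?c (p - i)))"
      unfolding split by (intro sum.insert) simp_all
    moreover have "(-1) ^ p * (-1) ^ p * ?c (p + p) * ?c (p - p) = ?c (2 * p)"
      by (simp only: minus_one_mult_self mult_2[symmetric]) (simp add: c_of_def)
    ultimately show ?thesis by simp
  qed
  also have "(\<Sum>i=1..p-1. 2 * ((-1) ^ p * (-1) ^ i * ?c (p + i) * ?c (p - i)))
      = (\<Sum>i=1..p-1. 8 * (-1) ^ p * ((-1) ^ i * b (p + i) * b (p - i)))"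
    by (rule sum.cong) (use assms in \<open>auto simp: c_of_def mult_ac\<close>)
  also have "\<dots> = 8 * (-1) ^ p * (\<Sum>i=1..p-1. (-1) ^ i * b (p + i) * b (p - i))"
    by (simp add: sum_distrib_left)
  also have "?f p = 4 * (-1) ^ p * b p ^ 2"
    using assms by (simp add: c_of_def power2_eq_square mult_ac)
  also have "2 * ?c (2 * p) = 4 * (-1) ^ p * ((-1) ^ p * b (2 * p))"
    using assms by (simp add: c_of_def mult.assoc left_minus_one_mult_self)
  finally show ?thesis by (simp add: b_relation_def algebra_simps)
qed

lemma c_series_box:
  "Abs_fps (c_of (box_b b x y)) = Abs_fps (c_of b) *
    ((1 + fps_const x * fps_X) * (1 + fps_const y * fps_X) * (Abs_fps (\<lambda>n. x ^ n) * Abs_fps (\<lambda>n. y ^ n)))"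
proof -
  let ?h = "Abs_fps (\<lambda>n. x ^ n) * Abs_fps (\<lambda>n. y ^ n)"
  let ?P = "(1 + fps_const (- x) * fps_X) * (1 + fps_const (- y) * fps_X)"
  have "?P * ?h = ((1 + fps_const (- x) * fps_X) * Abs_fps (\<lambda>n. x ^ n))
      * ((1 + fps_const (- y) * fps_X) * Abs_fps (\<lambda>n. y ^ n))" by (simp only: mult_ac)
  then have Ph: "?P * ?h = 1" by (simp only: fps_geometric mult_1)
  have "(1 + fps_const x * fps_X) * (1 + fps_const y * fps_X)
      = ?P + fps_const (2 * (x + y)) * fps_X"
  proof -
    have eqs: "fps_const (- x) = - fps_const x" "fps_const (- y) = - fps_const y"
      "fps_const (2 * (x + y)) = 2 * (fps_const x + fps_const y)"
      by (simp_all add: fps_numeral_fps_const)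
    have "(1 + u * t) * (1 + v * t) = (1 + - u * t) * (1 + - v * t) + 2 * (u + v) * t"
      for u v t :: "'a fps" by (simp add: algebra_simps)
    from this[of "fps_const x" fps_X "fps_const y"] show ?thesis by (simp only: eqs)
  qed
  then have "(1 + fps_const x * fps_X) * (1 + fps_const y * fps_X) * ?h
      = (?P + fps_const (2 * (x + y)) * fps_X) * ?h" by (rule arg_cong)
  also have "\<dots> = 1 + fps_const (2 * (x + y)) * fps_X * ?h"
    by (subst distrib_right) (simp only: Ph)
  finally have "(1 + fps_const x * fps_X) * (1 + fps_const y * fps_X) * ?h
      = 1 + fps_const (2 * (x + y)) * fps_X * ?h" .
  moreover have "Abs_fps (c_of (box_b b x y))
      = Abs_fps (c_of b) * (1 + fps_const (2 * (x + y)) * fps_X * ?h)"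
  proof (rule fps_ext)
    fix p
    have *: "Abs_fps (c_of b) * (1 + fps_const (2 * (x + y)) * fps_X * ?h)
        = Abs_fps (c_of b) + fps_const (2 * (x + y)) * (fps_X * (?h * Abs_fps (c_of b)))"
      by (simp only: distrib_left mult_1_left mult_1_right mult_ac)
    show "fps_nth (Abs_fps (c_of (box_b b x y))) p
        = fps_nth (Abs_fps (c_of b) * (1 + fps_const (2 * (x + y)) * fps_X * ?h)) p"
    proof (cases p)
      case 0
      then show ?thesis unfolding * by (simp add: c_of_def)
    next
      case (Suc k)
      have nth: "fps_nth (A + fps_const r * (fps_X * Z)) (Suc k) = fps_nth A (Suc k) + r * fps_nth Z k"
        for A Z :: "'a fps" and r by simp
      have conv: "fps_nth (?h * Abs_fps (c_of b)) k
          = (\<Sum>j<Suc k. (\<Sum>a\<le>j. x ^ a * y ^ (j - a)) * c_of b (k - j))"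
        by (simp only: fps_mult_nth fps_nth_Abs_fps lessThan_Suc_atMost atMost_atLeast0)
      show ?thesis unfolding * Suc nth conv fps_nth_Abs_fps
        by (simp add: c_of_def[of _ "Suc k"] box_b_def distrib_left distrib_right mult.assoc)
    qed
  qed
  ultimately show ?thesis by simp
qed

lemma b_relation_box:
  assumes "p \<ge> 1"
  shows "4 * b_relation (box_b b x y) p = 4 * b_relation b p"
proof -
  let ?C = "Abs_fps (c_of b)" and ?n = fps_neg_arg
  let ?Q = "(1 + fps_const x * fps_X) * (1 + fps_const y * fps_X)"
  let ?P = "(1 + fps_const (- x) * fps_X) * (1 + fps_const (- y) * fps_X)"
  let ?h = "Abs_fps (\<lambda>n. x ^ n) * Abs_fps (\<lambda>n. y ^ n)"
  have "?P * ?h = ((1 + fps_const (- x) * fps_X) * Abs_fps (\<lambda>n. x ^ n))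
      * ((1 + fps_const (- y) * fps_X) * Abs_fps (\<lambda>n. y ^ n))" by (simp only: mult_ac)
  then have Ph: "?P * ?h = 1" by (simp only: fps_geometric mult_1)
  have nQ: "?n ?Q = ?P" by (simp only: fps_neg_arg_mult fps_neg_arg_lin)
  have nP: "?n ?P = ?Q" by (simp only: fps_neg_arg_mult fps_neg_arg_lin minus_minus)
  have "?Q * ?n ?h = ?n (?P * ?h)" by (simp only: fps_neg_arg_mult[of ?P] nP)
  then have Qh: "?Q * ?n ?h = 1" by (simp only: Ph fps_neg_arg_one)
  have "Abs_fps (c_of (box_b b x y)) * ?n (Abs_fps (c_of (box_b b x y)))
      = ?C * (?Q * ?h) * (?n ?C * (?P * ?n ?h))"
    by (simp only: c_series_box fps_neg_arg_mult[of ?C] fps_neg_arg_mult[of ?Q] nQ)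
  also have "\<dots> = ?C * ?n ?C * ((?P * ?h) * (?Q * ?n ?h))" by (simp only: mult_ac)
  also have "\<dots> = ?C * ?n ?C" by (simp only: Ph Qh mult_1_right)
  finally have "4 * (-1) ^ p * b_relation (box_b b x y) p = 4 * (-1) ^ p * b_relation b p"
    using c_series_coeff[OF assms, of "box_b b x y"] c_series_coeff[OF assms, of b] by simp
  then have "(-1) ^ p * (4 * (-1) ^ p * b_relation (box_b b x y) p)
      = (-1) ^ p * (4 * (-1) ^ p * b_relation b p)" by simp
  moreover have "(-1) ^ p * (4 * (-1) ^ p * z) = 4 * z" for z :: 'a
  proof -
    have "(-1) ^ p * (4 * (-1) ^ p * z) = 4 * ((-1) ^ p * (-1) ^ p) * z" by (simp only: mult_ac)
    then show ?thesis by (simp only: minus_one_mult_self mult_1_right)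
  qed
  ultimately show ?thesis by simp
qed

definition s_box_b :: "nat \<Rightarrow> gamma mpoly" where
  "s_box_b p = box_b (\<lambda>i. Const (gamma_b i)) (Var 1) (Var 2) p"

lemma s_box_b_relation:
  assumes "p \<ge> 1"
  shows "b_relation s_box_b p = 0"
proof -
  let ?beta = "box_b (\<lambda>i. Const (free_b i)) (Var 1) (Var 2) :: nat \<Rightarrow> int mpoly mpoly"
  let ?pi = "mpoly_eval (Const \<circ> abs_gamma) Var :: int mpoly mpoly \<Rightarrow> gamma mpoly"
  have hom: "is_ring_hom (Const \<circ> abs_gamma)"
    by (intro ring_hom_comp is_ring_hom_Const is_ring_hom_abs_gamma)
  then have pi: "is_ring_hom ?pi" by (rule is_ring_hom_mpoly_eval)
  have "4 * b_relation ?beta p = 4 * b_relation (\<lambda>i. Const (free_b i)) p"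
    by (rule b_relation_box[OF assms])
  moreover have "f = g" if "4 * f = 4 * g" for f g :: "int mpoly mpoly"
  proof (intro poly_mapping_eqI)
    fix m m'
    have four: "4 * h = h + h + h + h" for h :: "int mpoly mpoly"
    proof -
      have "4 * h = (1 + 1 + 1 + 1) * h" by simp
      then show ?thesis by (simp only: distrib_right mult_1)
    qed
    have "Poly_Mapping.lookup (Poly_Mapping.lookup (f + f + f + f) m) m'
        = Poly_Mapping.lookup (Poly_Mapping.lookup (g + g + g + g) m) m'"
      by (simp only: that four[symmetric])
    then show "Poly_Mapping.lookup (Poly_Mapping.lookup f m) m'
        = Poly_Mapping.lookup (Poly_Mapping.lookup g m) m'"
      unfolding lookup_add by simp
  qed
  ultimately have "b_relation ?beta p = b_relation (\<lambda>i. Const (free_b i)) p" by blast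
  also have "\<dots> = Const (b_relation free_b p)"
    by (simp add: ring_hom_b_relation[OF is_ring_hom_Const])
  finally have "?pi (b_relation ?beta p) = Const (abs_gamma (b_relation free_b p))"
    by (simp add: mpoly_eval_Const[OF hom])
  also have "abs_gamma (b_relation free_b p) = 0"
    using b_ideal_props(6)[OF assms] by (simp add: zero_gamma_def gamma.abs_eq_iff)
  also have "Const (0 :: gamma) = 0" by (simp add: Const_def)
  also have "?pi (b_relation ?beta p) = b_relation s_box_b p"
    by (simp add: ring_hom_b_relation[OF pi] ring_hom_box_b[OF pi] mpoly_eval_Const[OF hom]
        mpoly_eval_Var[OF hom] s_box_b_def[abs_def] gamma_b.abs_eq)
  finally show ?thesis .
qed

lift_definition gamma_s_box :: "gamma \<Rightarrow> gamma mpoly" is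
  "mpoly_eval of_int (\<lambda>k. s_box_b (k + 1))"
proof -
  let ?e = "mpoly_eval of_int (\<lambda>k. s_box_b (k + 1)) :: int mpoly \<Rightarrow> gamma mpoly"
  have hom: "is_ring_hom ?e" by (intro is_ring_hom_mpoly_eval is_ring_hom_of_int)
  have "?e (b_relation free_b p) = 0" if "p \<ge> 1" for p
  proof -
    have "?e (b_relation free_b p) = b_relation (\<lambda>i. ?e (free_b i)) p"
      by (rule ring_hom_b_relation[OF hom])
    also have "\<dots> = b_relation s_box_b p"
      using that by (intro b_relation_cong) (auto simp: free_b_def mpoly_eval_Var is_ring_hom_of_int)
    finally show ?thesis using s_box_b_relation[OF that] by simp
  qed
  then have "?e (f - g) = 0" if "f - g \<in> b_ideal" for f g
    using ring_hom_b_ideal[OF hom _ that] by blast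
  then show "?e f = ?e g" if "f - g \<in> b_ideal" for f g
    using that ring_homD(6)[OF hom, of f g] by (metis eq_iff_diff_eq_0)
qed

definition s_box_act :: "gamma mpoly \<Rightarrow> gamma mpoly" where
  "s_box_act = mpoly_eval gamma_s_box
     (\<lambda>j. if j = 1 then - Var 2 else if j = 2 then - Var 1 else Var j)"

lemma is_ring_hom_gamma_s_box: "is_ring_hom gamma_s_box"
proof -
  have hom: "is_ring_hom (mpoly_eval of_int (\<lambda>k. s_box_b (k + 1)) :: int mpoly \<Rightarrow> gamma mpoly)"
    by (intro is_ring_hom_mpoly_eval is_ring_hom_of_int)
  show ?thesis
    unfolding is_ring_hom_def
  proof (intro conjI allI)
    show "gamma_s_box 1 = 1" by transfer (rule ring_homD(2)[OF hom])
    show "gamma_s_box (x + y) = gamma_s_box x + gamma_s_box y" for x y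
      by transfer (rule ring_homD(3)[OF hom])
    show "gamma_s_box (x * y) = gamma_s_box x * gamma_s_box y" for x y
      by transfer (rule ring_homD(4)[OF hom])
  qed
qed

lemma s_box_act_values:
  "is_ring_hom s_box_act" "s_box_act (Var 1) = - Var 2" "s_box_act (Var 2) = - Var 1"
  "j \<noteq> 1 \<Longrightarrow> j \<noteq> 2 \<Longrightarrow> s_box_act (Var j) = Var j"
  "p \<ge> 1 \<Longrightarrow> s_box_act (Const (gamma_b p)) = Const (gamma_b p) + (Var 1 + Var 2) *
     (\<Sum>j<p. (\<Sum>a\<le>j. Var 1 ^ a * Var 2 ^ (j - a)) * Const (c_of gamma_b (p - 1 - j)))"
proof -
  note hom = is_ring_hom_gamma_s_box
  show "is_ring_hom s_box_act" unfolding s_box_act_def by (rule is_ring_hom_mpoly_eval[OF hom])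
  show "s_box_act (Var 1) = - Var 2" "s_box_act (Var 2) = - Var 1"
    "j \<noteq> 1 \<Longrightarrow> j \<noteq> 2 \<Longrightarrow> s_box_act (Var j) = Var j"
    by (simp_all add: s_box_act_def mpoly_eval_Var[OF hom])
  assume "p \<ge> 1"
  then have "gamma_s_box (gamma_b p) = s_box_b p"
    by (simp add: gamma_b.abs_eq gamma_s_box.abs_eq free_b_def mpoly_eval_Var is_ring_hom_of_int)
  moreover have "c_of (\<lambda>i. Const (gamma_b i)) i = (Const (c_of gamma_b i) :: gamma mpoly)" for i
    by (simp add: c_of_def ring_homD[OF is_ring_hom_Const])
  ultimately show "s_box_act (Const (gamma_b p)) = Const (gamma_b p) + (Var 1 + Var 2) *
     (\<Sum>j<p. (\<Sum>a\<le>j. Var 1 ^ a * Var 2 ^ (j - a)) * Const (c_of gamma_b (p - 1 - j)))"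
    by (simp add: s_box_act_def mpoly_eval_Const[OF hom] s_box_b_def box_b_def)
qed

lemma s_act_values:
  "is_ring_hom (s_act i)" "s_act i (Var j) = Var (transpose i (i + 1) j)"
  "s_act i (Const g) = Const g"
  by (simp_all add: s_act_def is_ring_hom_mpoly_eval is_ring_hom_Const mpoly_eval_Var mpoly_eval_Const)

text \<open>
  A signed permutation of \<open>{1..n}\<close> is represented as an odd bijection of the integers that
  fixes everything outside \<open>{-n..n}\<close>; the one-line notation is \<open>(w 1, \<dots>, w n)\<close>.
\<close>

definition signed_perms_D :: "nat \<Rightarrow> (int \<Rightarrow> int) set" where
  "signed_perms_D n = {w. w permutes {- int n..int n} \<and> (\<forall>k. w (- k) = - w k)
     \<and> even (card {k \<in> {1..int n}. w k < 0})}"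

definition s_perm :: "nat \<Rightarrow> int \<Rightarrow> int" where
  "s_perm i = transpose (int i) (int i + 1) \<circ> transpose (- int i) (- (int i + 1))"

definition s_box_perm :: "int \<Rightarrow> int" where
  "s_box_perm = transpose 1 (- 2) \<circ> transpose 2 (- 1)"

text \<open>
  \<open>D_acts n w \<phi>\<close>: the signed permutation \<open>w\<close> acts by the map \<open>\<phi>\<close>, i.e. \<open>w\<close> is a product of
  generators and \<open>\<phi>\<close> is the composite of their actions in the same order.
\<close>

inductive D_acts :: "nat \<Rightarrow> (int \<Rightarrow> int) \<Rightarrow> (gamma mpoly \<Rightarrow> gamma mpoly) \<Rightarrow> bool" for n where
  D_acts_id: "D_acts n id id"
| D_acts_s: "D_acts n w \<phi> \<Longrightarrow> 1 \<le> i \<Longrightarrow> i < n \<Longrightarrow> D_acts n (w \<circ> s_perm i) (\<phi> \<circ> s_act i)"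
| D_acts_box: "D_acts n w \<phi> \<Longrightarrow> D_acts n (w \<circ> s_box_perm) (\<phi> \<circ> s_box_act)"

definition D_invariants :: "nat \<Rightarrow> gamma mpoly set" where
  "D_invariants n = {f \<in> poly_X n. \<forall>w \<in> signed_perms_D n. \<forall>\<phi>. D_acts n w \<phi> \<longrightarrow> \<phi> f = f}"

lemma s_perm_in_signed_perms_D:
  assumes "1 \<le> i" "i < n"
  shows "s_perm i \<in> signed_perms_D n"
proof -
  have "s_perm i permutes {- int n..int n}"
    unfolding s_perm_def using assms by (intro permutes_compose permutes_swap_id) auto
  moreover have "s_perm i (- k) = - s_perm i k" for k
    using assms by (auto simp: s_perm_def transpose_def)
  moreover have "{k \<in> {1..int n}. s_perm i k < 0} = {}"
    using assms by (auto simp: s_perm_def transpose_def)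
  ultimately show ?thesis by (simp add: signed_perms_D_def del: Collect_empty_eq)
qed

lemma s_box_perm_in_signed_perms_D:
  assumes "n \<ge> 2"
  shows "s_box_perm \<in> signed_perms_D n"
proof -
  have "s_box_perm permutes {- int n..int n}"
    unfolding s_box_perm_def using assms by (intro permutes_compose permutes_swap_id) auto
  moreover have "s_box_perm (- k) = - s_box_perm k" for k
    by (auto simp: s_box_perm_def transpose_def)
  moreover have "{k \<in> {1..int n}. s_box_perm k < 0} = {1, 2}"
    using assms by (auto simp: s_box_perm_def transpose_def split: if_splits)
  ultimately show ?thesis by (simp add: signed_perms_D_def)
qed

lemma D_invariants_iff:
  assumes "n \<ge> 2"
  shows "f \<in> D_invariants n \<longleftrightarrow>
    f \<in> poly_X n \<and> (\<forall>i. 1 \<le> i \<and> i < n \<longrightarrow> s_act i f = f) \<and> s_box_act f = f"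
proof
  assume f: "f \<in> D_invariants n"
  have "s_act i f = f" if "1 \<le> i" "i < n" for i
    using f D_acts_s[OF D_acts_id that] s_perm_in_signed_perms_D[OF that]
    by (auto simp: D_invariants_def)
  moreover have "s_box_act f = f"
    using f D_acts_box[OF D_acts_id, of n] s_box_perm_in_signed_perms_D[OF assms]
    by (auto simp: D_invariants_def)
  ultimately show "f \<in> poly_X n \<and> (\<forall>i. 1 \<le> i \<and> i < n \<longrightarrow> s_act i f = f) \<and> s_box_act f = f"
    using f by (auto simp: D_invariants_def)
next
  assume f: "f \<in> poly_X n \<and> (\<forall>i. 1 \<le> i \<and> i < n \<longrightarrow> s_act i f = f) \<and> s_box_act f = f"
  have "\<phi> f = f" if "D_acts n w \<phi>" for w \<phi>
    using that by (induction) (use f in auto)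
  with f show "f \<in> D_invariants n" by (auto simp: D_invariants_def)
qed


section \<open>Eta polynomials\<close>

inductive_set subring_gen :: "'a::comm_ring_1 set \<Rightarrow> 'a set" for S where
  gen: "a \<in> S \<Longrightarrow> a \<in> subring_gen S"
| one: "1 \<in> subring_gen S"
| diff: "a \<in> subring_gen S \<Longrightarrow> c \<in> subring_gen S \<Longrightarrow> a - c \<in> subring_gen S"
| mult: "a \<in> subring_gen S \<Longrightarrow> c \<in> subring_gen S \<Longrightarrow> a * c \<in> subring_gen S"

definition elem_sym :: "nat \<Rightarrow> nat \<Rightarrow> gamma mpoly" where
  "elem_sym n j = (\<Sum>A | A \<subseteq> {1..n} \<and> card A = j. \<Prod>i\<in>A. Var i)"

definition eta_b :: "nat \<Rightarrow> nat \<Rightarrow> gamma mpoly" where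
  "eta_b n p = (if p < n
     then elem_sym n p + 2 * (\<Sum>j<p. Const (gamma_b (p - j)) * elem_sym n j)
     else (\<Sum>j\<le>p. Const (gamma_b (p - j)) * elem_sym n j))"

definition eta_b' :: "nat \<Rightarrow> gamma mpoly" where
  "eta_b' n = (\<Sum>j<n. Const (gamma_b (n - j)) * elem_sym n j)"

definition eta_ring :: "nat \<Rightarrow> gamma mpoly set" where
  "eta_ring n = subring_gen (insert (eta_b' n) (eta_b n ` {1..}))"

end

theory Submission
  imports Defs
begin

text \<open>
  Write \<open>W\<^sub>n\<close> for the group and \<open>B(t) = \<Sum> b\<^sub>p t\<^sup>p\<close>, \<open>E\<^sub>n(t) = \<Prod> (1 + x\<^sub>j t)\<close> with \<open>j\<close> from 1 to \<open>n\<close>. The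
  eta polynomials of level \<open>n\<close> are the coefficients of \<open>D\<^sub>n = (2B - 1) E\<^sub>n\<close> in degrees below \<open>n\<close>, those
  of \<open>T\<^sub>n = B E\<^sub>n\<close> in degrees from \<open>n\<close> on, and the coefficient of \<open>T\<^sub>n - E\<^sub>n\<close> in degree \<open>n\<close>. The
  generators \<open>s\<^sub>i\<close> fix both series, \<open>s\<^sub>\<box>\<close> fixes \<open>D\<^sub>n\<close>, and it changes \<open>T\<^sub>n\<close> and \<open>E\<^sub>n\<close> in degrees below
  \<open>n\<close> only (\<open>s_box_series\<close>). So eta polynomials are invariant.

  That every invariant is an eta polynomial is shown by induction on \<open>n\<close>, descending from \<open>W\<^sub>n\<^sub>-\<^sub>1\<close>
  to \<open>W\<^sub>n\<close>. Let \<open>R\<^sub>n\<close> be the ring of eta polynomials of level \<open>n\<close> with all variables \<open>x\<^sub>j\<close>,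
  \<open>j \<notin> {1..n}\<close>, adjoined. The ring \<open>R\<^sub>1\<close> is the whole polynomial ring over \<open>\<Gamma>'\<close> (\<open>eta_ext_1\<close>). Let
  \<open>m = n - 1\<close>, \<open>x = x\<^sub>n\<close> and \<open>y = \<^sup>mb'\<^sub>m\<close>. Two facts carry the induction step.

  First, \<open>R\<^sub>m\<close> is generated as a module over \<open>R\<^sub>n\<close> by the elements \<open>x\<^sup>i\<close> and \<open>y x\<^sup>i\<close> with \<open>i < n\<close>
  (\<open>eta_ext_span\<close>). Indeed \<open>T\<^sub>n = (1 + x t) T\<^sub>m\<close> and likewise for \<open>D\<^sub>n\<close>, so that \<open>R\<^sub>m\<close> is
  generated as a ring by \<open>x\<close> and \<open>y\<close> over \<open>R\<^sub>n\<close>; the relations that cut down the powers are the equation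
  \<open>x (d\<^sub>m - 2y) = x\<^sub>1 \<dots> x\<^sub>n\<close>, where \<open>d\<^sub>m\<close> is the \<open>m\<close>-th coefficient of \<open>D\<^sub>m\<close>, and a quadratic equation
  for \<open>y\<close> (\<open>eta_quadratic_relation\<close>) that comes from the relations of \<open>\<Gamma>'\<close>. Geometrically,
  this is the cohomology of a bundle of quadrics of dimension \<open>2m\<close>, where \<open>x\<close> is the hyperplane class
  up to sign and \<open>y\<close> a class of middle degree.

  Second, there is an analogue of integration along this quadric: the composite \<open>\<Phi>\<close> of the \<open>2m\<close>
  divided differences along a reduced word for the longest minimal coset representative of
  \<open>W\<^sub>n / W\<^sub>m\<close>. It is linear over
  \<open>W\<^sub>n\<close>-invariants, in particular over \<open>R\<^sub>n\<close>, and lowers degrees by \<open>2m\<close>. So it maps the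
  generators of the module to integers, hence \<open>R\<^sub>m\<close> into \<open>R\<^sub>n\<close> (\<open>dds_eta_ext\<close>), and
  \<open>\<Phi> (y x\<^sup>m) = \<plusminus>1\<close> (\<open>dds_unit\<close>), which reduces to \<open>\<Phi> (x\<^sup>2\<^sup>m) = -2\<close> and is computed with generating
  functions (\<open>dds_coset_word_power\<close>).

  Now a \<open>W\<^sub>n\<close>-invariant \<open>f\<close> lies in \<open>R\<^sub>m\<close> by induction, and \<open>f = \<plusminus> f \<Phi> (y x\<^sup>m) = \<plusminus> \<Phi> (f y x\<^sup>m)\<close> lies in
  \<open>R\<^sub>n\<close> (\<open>descent\<close>). If \<open>f\<close> involves only \<open>x\<^sub>1, \<dots>, x\<^sub>n\<close>, setting the adjoined variables to 0
  exhibits it as an eta polynomial.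
\<close>


section \<open>Generated subrings and spans over them\<close>

lemma subring_gen_zero: "0 \<in> subring_gen S"
  using subring_gen.diff[OF subring_gen.one subring_gen.one] by simp

lemma subring_gen_uminus: "a \<in> subring_gen S \<Longrightarrow> - a \<in> subring_gen S"
  using subring_gen.diff[OF subring_gen_zero] by fastforce

lemma subring_gen_add: "a \<in> subring_gen S \<Longrightarrow> c \<in> subring_gen S \<Longrightarrow> a + c \<in> subring_gen S"
  using subring_gen.diff[of a S "- c"] subring_gen_uminus[of c] by simp

lemma subring_gen_sum: "(\<And>i. i \<in> A \<Longrightarrow> f i \<in> subring_gen S) \<Longrightarrow> sum f A \<in> subring_gen S"
  by (induction A rule: infinite_finite_induct) (auto intro: subring_gen_zero subring_gen_add)

lemma subring_gen_prod: "(\<And>i. i \<in> A \<Longrightarrow> f i \<in> subring_gen S) \<Longrightarrow> prod f A \<in> subring_gen S"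
  by (induction A rule: infinite_finite_induct) (auto intro: subring_gen.one subring_gen.mult)

lemma subring_gen_power: "a \<in> subring_gen S \<Longrightarrow> a ^ k \<in> subring_gen S"
  by (induction k) (auto intro: subring_gen.one subring_gen.mult)

lemma subring_gen_of_nat: "of_nat k \<in> subring_gen S"
  by (induction k) (auto intro: subring_gen_zero subring_gen.one subring_gen_add)

lemma subring_gen_of_int: "of_int k \<in> subring_gen S"
  by (cases k rule: int_diff_cases) (auto intro: subring_gen_of_nat subring_gen.diff)

lemma subring_gen_numeral: "numeral k \<in> subring_gen S"
  using subring_gen_of_nat[of "numeral k"] by simp

lemmas subring_gen_intros = subring_gen.one subring_gen.diff subring_gen.mult
  subring_gen_zero subring_gen_uminus subring_gen_add subring_gen_power subring_gen_of_int
  subring_gen_numeral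

lemma subring_gen_least:
  assumes "a \<in> subring_gen S" "S \<subseteq> subring_gen S'"
  shows "a \<in> subring_gen S'"
  using assms(1) by induction (use assms(2) in \<open>auto intro: subring_gen_intros\<close>)

lemma ring_hom_subring_gen:
  assumes "is_ring_hom h" "a \<in> subring_gen S"
  shows "h a \<in> subring_gen (h ` S)"
  using assms(2)
  by induction (auto simp: ring_homD[OF assms(1)] intro: subring_gen.intros)

lemma ring_hom_eq_on_subring_gen:
  assumes "is_ring_hom h" "is_ring_hom h'" "\<And>s. s \<in> S \<Longrightarrow> h s = h' s" "a \<in> subring_gen S"
  shows "h a = h' a"
  using assms(4)
  by induction (auto simp: ring_homD[OF assms(1)] ring_homD[OF assms(2)] assms(3))

text \<open>The scalars form a subring \<open>R\<close> of the ambient ring, given as a set and not as a type.\<close>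

inductive_set lin_span :: "'a::comm_ring_1 set \<Rightarrow> 'a set \<Rightarrow> 'a set" for R G where
  zero: "0 \<in> lin_span R G"
| step: "f \<in> lin_span R G \<Longrightarrow> a \<in> R \<Longrightarrow> g \<in> G \<Longrightarrow> a * g + f \<in> lin_span R G"

lemma lin_span_add: "f \<in> lin_span R G \<Longrightarrow> f' \<in> lin_span R G \<Longrightarrow> f + f' \<in> lin_span R G"
  by (induction rule: lin_span.induct) (auto simp: add.assoc intro: lin_span.intros)

lemma lin_span_sum: "(\<And>i. i \<in> A \<Longrightarrow> f i \<in> lin_span R G) \<Longrightarrow> sum f A \<in> lin_span R G"
  by (induction A rule: infinite_finite_induct) (auto intro: lin_span.zero lin_span_add)

lemma lin_span_term: "a \<in> R \<Longrightarrow> g \<in> G \<Longrightarrow> a * g \<in> lin_span R G"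
  using lin_span.step[OF lin_span.zero] by fastforce

lemma lin_span_base: "g \<in> G \<Longrightarrow> g \<in> lin_span (subring_gen S) G"
  using lin_span_term[OF subring_gen.one] by fastforce

lemma lin_span_mono: "f \<in> lin_span R G \<Longrightarrow> G \<subseteq> H \<Longrightarrow> f \<in> lin_span R H"
  by (induction rule: lin_span.induct) (auto intro: lin_span.intros)

lemma lin_span_mult:
  assumes "f \<in> lin_span (subring_gen S) G" "f' \<in> lin_span (subring_gen S) H"
    "\<And>g h. g \<in> G \<Longrightarrow> h \<in> H \<Longrightarrow> g * h \<in> lin_span (subring_gen S) K"
  shows "f * f' \<in> lin_span (subring_gen S) K"
proof -
  let ?R = "subring_gen S"
  have scale: "a * u \<in> lin_span ?R K" if "u \<in> lin_span ?R K" "a \<in> ?R" for a u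
    using that(1)
  proof induction
    case (step u c g)
    then have "(a * c) * g + a * u \<in> lin_span ?R K"
      using that(2) by (intro lin_span.step subring_gen.mult)
    then show ?case by (simp add: algebra_simps)
  qed (simp add: lin_span.zero)
  have one: "g * f' \<in> lin_span ?R K" if "g \<in> G" for g
    using assms(2)
  proof induction
    case (step u c h)
    then have "c * (g * h) + g * u \<in> lin_span ?R K"
      using assms(3)[OF that] scale lin_span_add by blast
    then show ?case by (simp add: algebra_simps)
  qed (simp add: lin_span.zero)
  show ?thesis using assms(1)
  proof induction
    case (step u c g)
    then have "c * (g * f') + u * f' \<in> lin_span ?R K" using one scale lin_span_add by blast
    then show ?case by (simp add: algebra_simps)
  qed (simp add: lin_span.zero)
qed

lemma lin_span_scale:
  assumes "a \<in> subring_gen S" "f \<in> lin_span (subring_gen S) G"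
  shows "a * f \<in> lin_span (subring_gen S) G"
  by (rule lin_span_mult[of a S "{1}" f G])
    (use assms lin_span_term[of a "subring_gen S" 1 "{1}"] in \<open>auto intro: lin_span_base\<close>)

lemma lin_span_uminus:
  assumes "f \<in> lin_span (subring_gen S) G"
  shows "- f \<in> lin_span (subring_gen S) G"
  using lin_span_scale[OF subring_gen_uminus[OF subring_gen.one] assms] by simp

lemma lin_span_diff:
  assumes "f \<in> lin_span (subring_gen S) G" "f' \<in> lin_span (subring_gen S) G"
  shows "f - f' \<in> lin_span (subring_gen S) G"
  using lin_span_add[OF assms(1) lin_span_uminus[OF assms(2)]] by simp

lemma lin_span_mult_left:
  assumes "f \<in> lin_span (subring_gen S) G" "\<And>g. g \<in> G \<Longrightarrow> y * g \<in> lin_span (subring_gen S) K"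
  shows "y * f \<in> lin_span (subring_gen S) K"
  by (rule lin_span_mult[of y S "{y}" f G]) (use assms in \<open>auto intro: lin_span_base\<close>)

text \<open>The elements that multiply the span into itself form a ring, and they lie in the span
  as soon as 1 does.\<close>

lemma subring_gen_subset_lin_span:
  assumes gens: "\<And>s g. s \<in> S' \<Longrightarrow> g \<in> G \<Longrightarrow> s * g \<in> lin_span (subring_gen S) G"
    and one: "1 \<in> lin_span (subring_gen S) G"
    and f: "f \<in> subring_gen S'"
  shows "f \<in> lin_span (subring_gen S) G"
proof -
  have "\<forall>u \<in> lin_span (subring_gen S) G. f * u \<in> lin_span (subring_gen S) G"
    using f
  proof induction
    case (gen s)
    then show ?case using gens lin_span_mult_left by blast
  qed (auto simp: left_diff_distrib mult.assoc intro: lin_span_diff)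
  with one show ?thesis by fastforce
qed


section \<open>Polynomials\<close>

lemma Const_mult: "Const (a * c) = (Const a * Const c :: 'a::comm_ring_1 mpoly)"
  using ring_homD(4)[OF is_ring_hom_Const] .

lemma Const_one: "Const 1 = (1 :: 'a::comm_ring_1 mpoly)"
  using ring_homD(2)[OF is_ring_hom_Const] .

lemma mon_eval_Var: "mon_eval Var m = (Poly_Mapping.single m 1 :: 'a::comm_ring_1 mpoly)"
proof -
  have pow: "Var i ^ k = (Poly_Mapping.single (Poly_Mapping.single i k) 1 :: 'a mpoly)" for i k
  proof (induction k)
    case (Suc k)
    then show ?case by (simp add: Var_def mult_single flip: single_add)
  qed simp
  have prod: "(\<Prod>i\<in>A. Poly_Mapping.single (f i) 1) = (Poly_Mapping.single (sum f A) 1 :: 'a mpoly)"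
    for A :: "nat set" and f
    by (induction A rule: infinite_finite_induct) (simp_all add: mult_single)
  show ?thesis
    unfolding mon_eval_def pow prod using mpoly_sum_monomials[of m] by simp
qed

lemma mpoly_eval_id: "mpoly_eval Const Var f = (f :: 'a::comm_ring_1 mpoly)"
  using mpoly_sum_monomials[of f] by (simp add: mpoly_eval_def mon_eval_Var Const_def mult_single)

lemma mpoly_in_subring_gen:
  fixes f :: "'a::comm_ring_1 mpoly"
  assumes "\<And>a. Const a \<in> subring_gen S" "\<And>i. Var i \<in> subring_gen S"
  shows "f \<in> subring_gen S"
proof -
  have "mpoly_eval Const Var f \<in> subring_gen S"
    unfolding mpoly_eval_def mon_eval_def
    by (intro subring_gen_sum subring_gen.mult subring_gen_prod subring_gen_power assms)
  then show ?thesis by (simp add: mpoly_eval_id)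
qed

lemma int_mpoly_generated: "f \<in> subring_gen (free_b ` {1..})"
proof (rule mpoly_in_subring_gen)
  fix i :: nat
  have "free_b (i + 1) \<in> subring_gen (free_b ` {1..})" by (intro subring_gen.gen imageI) simp
  then show "Var i \<in> subring_gen (free_b ` {1..})" by (simp add: free_b_def)
next
  fix a :: int
  have "Const a = (of_int a :: int mpoly)"
    using ring_homD(11)[OF is_ring_hom_Const[where 'a = int], of a] by simp
  then show "Const a \<in> subring_gen (free_b ` {1..})" by (simp add: subring_gen_of_int)
qed

lemma gamma_b_0: "gamma_b 0 = 1"
  by transfer (simp add: free_b_def b_ideal_props)

lemma gamma_mpoly_generated:
  "f \<in> subring_gen (range Var \<union> (\<lambda>p. Const (gamma_b p)) ` {1..})"
proof (rule mpoly_in_subring_gen)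
  fix a :: gamma
  obtain r where a: "a = abs_gamma r" by (induction a rule: gamma.abs_induct) auto
  have "Const (abs_gamma r) \<in> subring_gen ((\<lambda>p. Const (gamma_b p)) ` {1..})"
    using ring_hom_subring_gen[OF ring_hom_comp[OF is_ring_hom_Const is_ring_hom_abs_gamma]
        int_mpoly_generated[of r]]
    by (simp add: image_image gamma_b.abs_eq)
  then show "Const a \<in> subring_gen (range Var \<union> (\<lambda>p. Const (gamma_b p)) ` {1..})"
    unfolding a by (rule subring_gen_least) (auto intro: subring_gen.gen)
qed (auto intro: subring_gen.gen)

lemma lookup_Var_mult:
  fixes g :: "'a::comm_ring_1 mpoly"
  shows "Poly_Mapping.lookup (Var i * g) (m + Poly_Mapping.single i 1) = Poly_Mapping.lookup g m"
    and "Poly_Mapping.lookup m i = 0 \<Longrightarrow> Poly_Mapping.lookup (Var i * g) m = 0"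
proof -
  let ?e = "Poly_Mapping.single i 1 :: nat \<Rightarrow>\<^sub>0 nat"
  have "Var i * g = (\<Sum>k\<in>Poly_Mapping.keys g. Poly_Mapping.single (?e + k) (Poly_Mapping.lookup g k))"
    by (subst mpoly_sum_monomials[of g]) (simp add: Var_def sum_distrib_left mult_single)
  then have *: "Poly_Mapping.lookup (Var i * g) m'
      = (\<Sum>k\<in>Poly_Mapping.keys g. if m' = ?e + k then Poly_Mapping.lookup g k else 0)" for m'
    by (simp add: lookup_sum lookup_single when_def eq_commute)
  have "Poly_Mapping.lookup (Var i * g) (m + ?e)
      = (\<Sum>k\<in>Poly_Mapping.keys g. if m = k then Poly_Mapping.lookup g k else 0)"
    unfolding * by (intro sum.cong) (auto simp: add.commute)
  also have "\<dots> = Poly_Mapping.lookup g m" by (simp add: in_keys_iff)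
  finally show "Poly_Mapping.lookup (Var i * g) (m + ?e) = Poly_Mapping.lookup g m" .
  show "Poly_Mapping.lookup (Var i * g) m = 0" if "Poly_Mapping.lookup m i = 0"
    unfolding * by (intro sum.neutral) (use that in \<open>auto simp: lookup_add\<close>)
qed

text \<open>Comparing coefficients, a relation \<open>x\<^sub>i g = \<plusminus> x\<^sub>j g\<close> moves any coefficient of \<open>g\<close> to a
  monomial with a smaller power of \<open>x\<^sub>j\<close>, until there is none left. The argument also covers coefficient rings with zero
  divisors.\<close>

lemma Var_combination_regular:
  fixes g :: "'a::comm_ring_1 mpoly"
  assumes "i \<noteq> j" and "Var i * g = Var j * g \<or> Var i * g = - (Var j * g)"
  shows "g = 0"
proof (rule poly_mapping_eqI)
  let ?e = "\<lambda>i. Poly_Mapping.single i 1 :: nat \<Rightarrow>\<^sub>0 nat"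
  have move: "Poly_Mapping.lookup g m = 0"
    if "Poly_Mapping.lookup (Var j * g) (m + ?e i) = 0" for m
    using that assms(2) lookup_Var_mult(1)[of i g m] by auto
  have "\<forall>m. Poly_Mapping.lookup m j = k \<longrightarrow> Poly_Mapping.lookup g m = 0" for k
  proof (induction k)
    case 0
    show ?case
      using assms(1) by (intro allI impI move lookup_Var_mult(2)) (simp add: lookup_add lookup_single)
  next
    case (Suc k)
    show ?case
    proof (intro allI impI move)
      fix m assume m: "Poly_Mapping.lookup m j = Suc k"
      define m' where "m' = m - ?e j"
      have "m = m' + ?e j"
        using m by (intro poly_mapping_eqI) (auto simp: m'_def lookup_add lookup_minus lookup_single when_def)
      moreover have "Poly_Mapping.lookup (m' + ?e i) j = k"
        using m assms(1) by (simp add: m'_def lookup_add lookup_minus lookup_single)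
      ultimately have "Poly_Mapping.lookup (Var j * g) ((m' + ?e i) + ?e j) = 0"
        using Suc by (simp only: lookup_Var_mult(1))
      then show "Poly_Mapping.lookup (Var j * g) (m + ?e i) = 0"
        unfolding \<open>m = m' + ?e j\<close> by (simp only: add_ac)
    qed
  qed
  then show "Poly_Mapping.lookup g m = Poly_Mapping.lookup 0 m" for m by simp
qed


section \<open>Divided differences\<close>

text \<open>The letter 0 stands for \<open>s\<^sub>\<box>\<close>, so that \<open>W\<^sub>n\<close> is generated by the letters \<open>i < n\<close>.
  The root of the letter \<open>i\<close> is the linear form that divides every difference \<open>f - s\<^sub>i f\<close>.\<close>

definition s_gen :: "nat \<Rightarrow> gamma mpoly \<Rightarrow> gamma mpoly" where
  "s_gen i = (if i = 0 then s_box_act else s_act i)"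

definition root_form :: "nat \<Rightarrow> gamma mpoly" where
  "root_form i = (if i = 0 then Var 1 + Var 2 else Var i - Var (i + 1))"

lemma is_ring_hom_s_gen: "is_ring_hom (s_gen i)"
  by (simp add: s_gen_def s_box_act_values s_act_values)

lemma root_regular:
  assumes "root_form i * g = root_form i * h"
  shows "g = h"
proof -
  have "root_form i * (g - h) = 0" using assms by (simp add: algebra_simps)
  then have "g - h = 0"
    by (intro Var_combination_regular[of "if i = 0 then 1 else i" "if i = 0 then 2 else i + 1"])
      (auto simp: root_form_def algebra_simps eq_neg_iff_add_eq_0 split: if_splits)
  then show ?thesis by simp
qed

text \<open>The filtration by degree, where \<open>x\<^sub>j\<close> has degree 1 and \<open>b\<^sub>p\<close> has degree \<open>p\<close>. Being generated
  by closure rules, it passes to the quotient \<open>\<Gamma>'\<close> without any analysis of the ideal of relations.\<close>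

inductive degree_le :: "nat \<Rightarrow> gamma mpoly \<Rightarrow> bool" where
  one: "degree_le 0 1"
| Var: "degree_le 1 (Var j)"
| b: "p \<ge> 1 \<Longrightarrow> degree_le p (Const (gamma_b p))"
| diff: "degree_le d f \<Longrightarrow> degree_le d g \<Longrightarrow> degree_le d (f - g)"
| mult: "degree_le d f \<Longrightarrow> degree_le e g \<Longrightarrow> degree_le (d + e) (f * g)"
| mono: "degree_le d f \<Longrightarrow> d \<le> e \<Longrightarrow> degree_le e f"

lemma degree_le_zero: "degree_le d 0"
  using degree_le.mono[OF degree_le.diff[OF degree_le.one degree_le.one], of d] by simp

lemma degree_le_uminus: "degree_le d f \<Longrightarrow> degree_le d (- f)"
  using degree_le.diff[OF degree_le_zero] by fastforce

lemma degree_le_add: "degree_le d f \<Longrightarrow> degree_le d g \<Longrightarrow> degree_le d (f + g)"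
  using degree_le.diff[of d f "- g"] degree_le_uminus[of d g] by simp

lemma degree_le_sum: "(\<And>i. i \<in> A \<Longrightarrow> degree_le d (f i)) \<Longrightarrow> degree_le d (sum f A)"
  by (induction A rule: infinite_finite_induct) (auto intro: degree_le_zero degree_le_add)

lemma degree_le_power: "degree_le d f \<Longrightarrow> degree_le (k * d) (f ^ k)"
  by (induction k) (auto intro: degree_le.one degree_le.mult)

lemma degree_le_Var_power: "degree_le k (Var j ^ k)"
  using degree_le_power[OF degree_le.Var, of k j] by simp

lemma degree_le_c: "degree_le p (Const (c_of gamma_b p))"
proof (cases "p = 0")
  case True
  then show ?thesis by (simp add: c_of_def Const_one degree_le.one)
next
  case False
  then have "degree_le p (Const (gamma_b p) + Const (gamma_b p))"
    by (intro degree_le_add degree_le.b) auto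
  then have "degree_le p (Const (2 * gamma_b p))"
    by (simp only: mult_2 ring_homD(3)[OF is_ring_hom_Const])
  then show ?thesis using False by (simp add: c_of_def)
qed

text \<open>Integers lie in every subring; so membership in a subring can follow from the degree alone.\<close>

lemma degree_le_0:
  assumes "degree_le 0 f"
  shows "\<exists>k. f = of_int k"
proof -
  have "\<exists>k. f = of_int k" if "degree_le d f" "d = 0" for d
    using that
  proof induction
    case one
    show ?case by (rule exI[of _ 1]) simp
  next
    case (diff d f g)
    then show ?case by (metis of_int_diff)
  next
    case (mult d f e g)
    then show ?case by (metis add_is_0 of_int_mult)
  qed auto
  with assms show ?thesis by blast
qed

lemma degree_le_exists: "\<exists>d. degree_le d f"
  using gamma_mpoly_generated[of f]
proof induction
  case (gen a)
  then show ?case using degree_le.Var degree_le.b by blast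
next
  case one
  show ?case using degree_le.one by blast
next
  case (diff a c)
  then obtain d e where "degree_le d a" "degree_le e c" by blast
  then have "degree_le (max d e) (a - c)"
    by (intro degree_le.diff degree_le.mono[OF _ max.cobounded1] degree_le.mono[OF _ max.cobounded2])
  then show ?case by blast
next
  case (mult a c)
  then show ?case using degree_le.mult by blast
qed

text \<open>The quotient of \<open>f - s\<^sub>i f\<close> by the root exists for each generator of the ring, and the
  twisted Leibniz rule extends this to products. The proof keeps track of degrees, since it is
  the drop in degree that matters later.\<close>

lemma difference_quotient_generator:
  shows "\<exists>g. root_form i * g = Var j - s_gen i (Var j) \<and> degree_le 0 g"
    and "p \<ge> 1 \<Longrightarrow> \<exists>g. root_form i * g = Const (gamma_b p) - s_gen i (Const (gamma_b p)) \<and> degree_le (p - 1) g"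
proof -
  have deg: "degree_le 0 0" "degree_le 0 1" "degree_le 0 (- 1)"
    by (auto intro: degree_le.one degree_le_uminus degree_le_zero)
  show "\<exists>g. root_form i * g = Var j - s_gen i (Var j) \<and> degree_le 0 g"
  proof (cases "i = 0")
    case True
    consider "j = 1" | "j = 2" | "j \<noteq> 1" "j \<noteq> 2" by blast
    then show ?thesis
    proof cases
      case 3
      then show ?thesis using True deg by (intro exI[of _ 0]) (simp add: s_gen_def s_box_act_values)
    next
      case 1
      then show ?thesis using True deg s_box_act_values(2)
        by (intro exI[of _ 1]) (simp add: s_gen_def root_form_def)
    next
      case 2
      then show ?thesis using True deg s_box_act_values(3)
        by (intro exI[of _ 1]) (simp add: s_gen_def root_form_def)
    qed
  next
    case False
    consider "j = i" | "j = i + 1" | "j \<noteq> i" "j \<noteq> i + 1" by blast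
    then show ?thesis
    proof cases
      case 1
      then show ?thesis
        using False deg by (intro exI[of _ 1]) (simp add: s_gen_def root_form_def s_act_values)
    next
      case 2
      then show ?thesis
        using False deg by (intro exI[of _ "- 1"]) (simp add: s_gen_def root_form_def s_act_values)
    next
      case 3
      then show ?thesis
        using False deg by (intro exI[of _ 0]) (simp add: s_gen_def root_form_def s_act_values)
    qed
  qed
  assume p: "p \<ge> 1"
  show "\<exists>g. root_form i * g = Const (gamma_b p) - s_gen i (Const (gamma_b p)) \<and> degree_le (p - 1) g"
  proof (cases "i = 0")
    case True
    let ?g = "\<Sum>j<p. (\<Sum>a\<le>j. Var 1 ^ a * Var 2 ^ (j - a)) * Const (c_of gamma_b (p - 1 - j))"
    have "degree_le (p - 1) ?g"
    proof (intro degree_le_sum)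
      fix j assume j: "j \<in> {..<p}"
      have "degree_le j (\<Sum>a\<le>j. Var 1 ^ a * Var 2 ^ (j - a))"
      proof (intro degree_le_sum)
        fix a assume "a \<in> {..j}"
        then show "degree_le j (Var 1 ^ a * Var 2 ^ (j - a))"
          using degree_le.mult[OF degree_le_Var_power[of a 1] degree_le_Var_power[of "j - a" 2]] by simp
      qed
      from degree_le.mult[OF this degree_le_c[of "p - 1 - j"]] j
      show "degree_le (p - 1)
          ((\<Sum>a\<le>j. Var 1 ^ a * Var 2 ^ (j - a)) * Const (c_of gamma_b (p - 1 - j)))" by simp
    qed
    then have "degree_le (p - 1) (- ?g)" by (rule degree_le_uminus)
    moreover have "root_form i * (- ?g) = Const (gamma_b p) - s_gen i (Const (gamma_b p))"
      using p True by (simp add: root_form_def s_gen_def s_box_act_values)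
    ultimately show ?thesis by blast
  next
    case False
    then show ?thesis
      by (intro exI[of _ 0]) (simp add: s_gen_def s_act_values degree_le_zero)
  qed
qed

lemma degree_le_root: "degree_le 1 (root_form i)"
  unfolding root_form_def using degree_le.diff[OF degree_le.Var degree_le.Var, of i "i + 1"]
    degree_le_add[OF degree_le.Var degree_le.Var, of 1 2] by simp

lemma difference_quotient:
  assumes "degree_le d f"
  shows "degree_le d (s_gen i f) \<and>
    (\<exists>g. root_form i * g = f - s_gen i f \<and> (if d = 0 then g = 0 else degree_le (d - 1) g))"
  using assms
proof induction
  case one
  then show ?case by (auto simp: ring_homD[OF is_ring_hom_s_gen] intro: degree_le.one)
next
  case (Var j)
  obtain g where g: "root_form i * g = Var j - s_gen i (Var j)" "degree_le 0 g"
    using difference_quotient_generator(1) by blast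
  from degree_le.mult[OF degree_le_root g(2)] have "degree_le 1 (root_form i * g)"
    by (simp only: add_0_right)
  from degree_le.diff[OF degree_le.Var[of j] this] show ?case using g by auto
next
  case (b p)
  obtain g where g: "root_form i * g = Const (gamma_b p) - s_gen i (Const (gamma_b p))" "degree_le (p - 1) g"
    using difference_quotient_generator(2)[OF b] by blast
  from degree_le.mult[OF degree_le_root g(2)] have "degree_le p (root_form i * g)" using b by simp
  from degree_le.diff[OF degree_le.b[OF b] this] show ?case using g b by auto
next
  case (diff d f f')
  then obtain g g' where "root_form i * g = f - s_gen i f" "root_form i * g' = f' - s_gen i f'"
    "if d = 0 then g = 0 else degree_le (d - 1) g" "if d = 0 then g' = 0 else degree_le (d - 1) g'"
    by blast
  then have "root_form i * (g - g') = (f - f') - s_gen i (f - f')"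
    "if d = 0 then g - g' = 0 else degree_le (d - 1) (g - g')"
    by (auto simp: ring_homD[OF is_ring_hom_s_gen] algebra_simps intro: degree_le.diff split: if_splits)
  moreover have "degree_le d (s_gen i (f - f'))"
    using diff by (auto simp: ring_homD[OF is_ring_hom_s_gen] intro: degree_le.diff)
  ultimately show ?case by blast
next
  case (mult d f e f')
  then obtain g g' where g: "root_form i * g = f - s_gen i f" "root_form i * g' = f' - s_gen i f'"
    "if d = 0 then g = 0 else degree_le (d - 1) g" "if e = 0 then g' = 0 else degree_le (e - 1) g'"
    by blast
  let ?h = "g * f' + s_gen i f * g'"
  have "root_form i * ?h = (root_form i * g) * f' + s_gen i f * (root_form i * g')" by (simp add: algebra_simps)
  also have "\<dots> = f * f' - s_gen i (f * f')"
    unfolding g by (simp add: ring_homD[OF is_ring_hom_s_gen] algebra_simps)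
  finally have quot: "root_form i * ?h = f * f' - s_gen i (f * f')" .
  moreover have "degree_le (d + e - 1) (g * f')" if "d \<noteq> 0"
    using degree_le.mult[of "d - 1" g e f'] mult.hyps g(3) that by simp
  moreover have "degree_le (d + e - 1) (s_gen i f * g')" if "e \<noteq> 0"
    using degree_le.mult[of d "s_gen i f" "e - 1" g'] mult.IH(1) g(4) that by simp
  ultimately have "if d + e = 0 then ?h = 0 else degree_le (d + e - 1) ?h"
    using g(3,4) by (auto intro!: degree_le_add simp: degree_le_zero split: if_splits)
  moreover have "degree_le (d + e) (s_gen i (f * f'))"
    using mult by (auto simp: ring_homD[OF is_ring_hom_s_gen] intro: degree_le.mult)
  ultimately show ?case using quot by blast
next
  case (mono d f e)
  then obtain g where g: "root_form i * g = f - s_gen i f" "if d = 0 then g = 0 else degree_le (d - 1) g"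
    by blast
  have "if e = 0 then g = 0 else degree_le (e - 1) g"
    using g(2) mono.hyps(2)
    by (auto intro: degree_le_zero degree_le.mono[of "d - 1" g] split: if_splits)
  moreover have "degree_le e (s_gen i f)" using mono degree_le.mono[of d "s_gen i f" e] by simp
  ultimately show ?case using g(1) by blast
qed

definition dd :: "nat \<Rightarrow> gamma mpoly \<Rightarrow> gamma mpoly" where
  "dd i f = (THE g. root_form i * g = f - s_gen i f)"

lemma dd_eqI: "root_form i * g = f - s_gen i f \<Longrightarrow> dd i f = g"
  unfolding dd_def by (rule the_equality) (auto intro: root_regular[of i])

lemma root_dd: "root_form i * dd i f = f - s_gen i f"
proof -
  obtain d where "degree_le d f" using degree_le_exists by blast
  from difference_quotient[OF this, of i] obtain g where "root_form i * g = f - s_gen i f" by blast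
  then show ?thesis using dd_eqI[of i g f] by simp
qed

lemma dd_add: "dd i (f + g) = dd i f + dd i g"
  by (rule dd_eqI) (simp add: distrib_left root_dd ring_homD[OF is_ring_hom_s_gen])

lemma dd_invariant_mult: "s_gen i a = a \<Longrightarrow> dd i (a * f) = a * dd i f"
  by (rule dd_eqI) (simp add: mult.left_commute[of "root_form i"] root_dd ring_homD[OF is_ring_hom_s_gen] right_diff_distrib)

lemma dd_degree: "degree_le d f \<Longrightarrow> if d = 0 then dd i f = 0 else degree_le (d - 1) (dd i f)"
proof -
  assume "degree_le d f"
  from difference_quotient[OF this, of i] obtain g where
    g: "root_form i * g = f - s_gen i f" "if d = 0 then g = 0 else degree_le (d - 1) g" by blast
  from g(2) show ?thesis unfolding dd_eqI[OF g(1)] .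
qed

definition dds :: "nat list \<Rightarrow> gamma mpoly \<Rightarrow> gamma mpoly" where
  "dds L = fold dd L"

lemma dds_simps [simp]: "dds [] f = f" "dds (i # L) f = dds L (dd i f)"
  "dds (L @ L') f = dds L' (dds L f)"
  by (simp_all add: dds_def)

lemma dds_add: "dds L (f + g) = dds L f + dds L g"
  by (induction L arbitrary: f g) (simp_all add: dd_add)

lemma dds_zero [simp]: "dds L 0 = 0"
  using dds_add[of L 0 0] by simp

lemma dds_invariant_mult:
  "(\<And>i. i \<in> set L \<Longrightarrow> s_gen i a = a) \<Longrightarrow> dds L (a * f) = a * dds L f"
  by (induction L arbitrary: f) (simp_all add: dd_invariant_mult)

lemma dds_degree:
  assumes "degree_le d f"
  shows "if d < length L then dds L f = 0 else degree_le (d - length L) (dds L f)"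
  using assms
proof (induction L arbitrary: d f)
  case (Cons i L)
  show ?case
  proof (cases "d = 0")
    case True
    then show ?thesis using dd_degree[OF Cons.prems, of i] by simp
  next
    case False
    then have "degree_le (d - 1) (dd i f)" using dd_degree[OF Cons.prems, of i] by simp
    note IH = Cons.IH[OF this]
    have "d - 1 < length L \<longleftrightarrow> d < length (i # L)" "d - 1 - length L = d - length (i # L)"
      using False by auto
    with IH show ?thesis by (simp only: dds_simps)
  qed
qed simp


section \<open>Power series and the composite of divided differences\<close>

definition fps_map :: "('a \<Rightarrow> 'b) \<Rightarrow> 'a fps \<Rightarrow> 'b fps" where
  "fps_map h F = Abs_fps (\<lambda>k. h (fps_nth F k))"

lemma fps_map_nth [simp]: "fps_nth (fps_map h F) k = h (fps_nth F k)"
  by (simp add: fps_map_def)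

lemma fps_map_hom:
  fixes h :: "'a::comm_ring_1 \<Rightarrow> 'b::comm_ring_1"
  assumes "is_ring_hom h"
  shows "fps_map h 1 = 1" "fps_map h (F + G) = fps_map h F + fps_map h G"
    "fps_map h (F - G) = fps_map h F - fps_map h G" "fps_map h (- F) = - fps_map h F"
    "fps_map h (F * G) = fps_map h F * fps_map h G" "fps_map h fps_X = fps_X"
    "fps_map h (fps_const c) = fps_const (h c)"
    "fps_map h 2 = 2"
    "fps_map h (F ^ k) = fps_map h F ^ k"
    "fps_map h (prod f A) = (\<Prod>a\<in>A. fps_map h (f a))"
proof -
  show one: "fps_map h 1 = 1" by (rule fps_ext) (simp add: ring_homD[OF assms])
  show add: "fps_map h (F + G) = fps_map h F + fps_map h G" for F G
    by (rule fps_ext) (simp add: ring_homD[OF assms])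
  show "fps_map h (F - G) = fps_map h F - fps_map h G" "fps_map h (- F) = - fps_map h F"
    "fps_map h fps_X = fps_X" "fps_map h (fps_const c) = fps_const (h c)"
    by (rule fps_ext, simp add: ring_homD[OF assms] fps_X_def)+
  show mult: "fps_map h (F * G) = fps_map h F * fps_map h G" for F G
    by (rule fps_ext) (simp add: fps_mult_nth ring_homD[OF assms])
  show "fps_map h 2 = 2" using add[of 1 1] one by simp
  show "fps_map h (F ^ k) = fps_map h F ^ k" by (induction k) (simp_all add: one mult)
  show "fps_map h (prod f A) = (\<Prod>a\<in>A. fps_map h (f a))"
    by (induction A rule: infinite_finite_induct) (simp_all add: one mult)
qed

definition geom :: "'a::comm_ring_1 \<Rightarrow> 'a fps" where
  "geom y = Abs_fps (\<lambda>k. y ^ k)"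

lemma geom_inverse: "(1 - fps_const y * fps_X) * geom y = 1"
  using fps_geometric[of y] by (simp add: geom_def flip: fps_const_neg)

lemma fps_map_geom: "is_ring_hom h \<Longrightarrow> fps_map h (geom y) = geom (h y)"
  by (rule fps_ext) (simp add: geom_def ring_homD)

lemma inverse_diff:
  fixes f g F G :: "'a::comm_ring_1"
  assumes "F * f = 1" "G * g = 1"
  shows "f - g = f * g * (G - F)"
proof -
  have "f * g * (G - F) = f * (G * g) - (F * f) * g" by (simp add: algebra_simps)
  then show ?thesis by (simp add: assms)
qed

lemma geom_diff: "geom y - geom z = fps_const (y - z) * fps_X * geom y * geom z"
  unfolding inverse_diff[OF geom_inverse geom_inverse, of y z]
  by (simp add: algebra_simps flip: fps_const_sub)

lemma geom_prod_diff:
  "geom y * geom z - geom (- y) * geom (- z)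
    = fps_const (y + z) * (2 * fps_X * ((geom y * geom (- y)) * (geom z * geom (- z))))"
proof -
  let ?L = "\<lambda>y. 1 - fps_const y * fps_X"
  have inv: "(?L y * ?L z) * (geom y * geom z) = 1" for y z :: 'a
  proof -
    have "(?L y * ?L z) * (geom y * geom z) = (?L y * geom y) * (?L z * geom z)"
      by (simp only: mult_ac)
    then show ?thesis by (simp only: geom_inverse mult_1)
  qed
  have "geom y * geom z - geom (- y) * geom (- z)
      = (geom y * geom z) * (geom (- y) * geom (- z)) * (?L (- y) * ?L (- z) - ?L y * ?L z)"
    by (rule inverse_diff[OF inv inv])
  also have "?L (- y) * ?L (- z) - ?L y * ?L z = fps_const (y + z) * (2 * fps_X)"
    by (simp add: algebra_simps flip: fps_const_add fps_const_neg)
  finally show ?thesis by (simp only: mult_ac)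
qed

lemma fps_dd_eqI:
  assumes "fps_const (root_form i) * G = F - fps_map (s_gen i) F"
  shows "fps_map (dd i) F = G"
proof (rule fps_ext)
  fix k
  have "fps_nth (fps_const (root_form i) * G) k = fps_nth (F - fps_map (s_gen i) F) k"
    using assms by simp
  then show "fps_nth (fps_map (dd i) F) k = fps_nth G k" by (simp add: dd_eqI)
qed

lemma s_gen_Var:
  "i \<noteq> 0 \<Longrightarrow> s_gen i (Var i) = Var (Suc i)" "i \<noteq> 0 \<Longrightarrow> s_gen i (Var (Suc i)) = Var i"
  "s_gen 0 (Var 1) = - Var 2" "s_gen 0 (Var 2) = - Var 1"
  "i \<noteq> 0 \<longrightarrow> j \<noteq> i \<Longrightarrow> j \<noteq> Suc i \<Longrightarrow> i = 0 \<longrightarrow> j \<noteq> 2 \<Longrightarrow> s_gen i (Var j) = Var j"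
  using s_box_act_values(2,3,4) by (auto simp: s_gen_def s_act_values)

text \<open>The powers of \<open>x\<^sub>n\<close> are handled together in \<open>1/(1 - x\<^sub>n t)\<close>, on which the divided differences
  take product form. The factors that occur are \<open>1/(1 - x\<^sub>j t)\<close> and \<open>1/(1 - x\<^sub>j\<^sup>2 t\<^sup>2)\<close>.\<close>

abbreviation gx :: "nat \<Rightarrow> gamma mpoly fps" where
  "gx j \<equiv> geom (Var j)"

abbreviation qx :: "nat \<Rightarrow> gamma mpoly fps" where
  "qx j \<equiv> geom (Var j) * geom (- Var j)"

lemmas fps_map_s_gen = fps_map_hom[OF is_ring_hom_s_gen] fps_map_geom[OF is_ring_hom_s_gen]
  ring_homD(5)[OF is_ring_hom_s_gen]

lemma dd_gx:
  assumes "i \<noteq> 0" "fps_map (s_gen i) K = K"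
  shows "fps_map (dd i) (K * gx (Suc i)) = - fps_X * K * (gx i * gx (Suc i))"
proof (rule fps_dd_eqI)
  have "K * gx (Suc i) - fps_map (s_gen i) (K * gx (Suc i)) = K * (gx (Suc i) - gx i)"
    using assms by (simp add: fps_map_s_gen s_gen_Var right_diff_distrib)
  also have "\<dots> = fps_const (root_form i) * (- fps_X * K * (gx i * gx (Suc i)))"
    using assms(1) unfolding geom_diff by (simp add: root_form_def algebra_simps flip: fps_const_sub)
  finally show "fps_const (root_form i) * (- fps_X * K * (gx i * gx (Suc i)))
      = K * gx (Suc i) - fps_map (s_gen i) (K * gx (Suc i))" by simp
qed

lemma dd_box_gx:
  assumes "fps_map (s_gen 0) K = K"
  shows "fps_map (dd 0) (K * (gx 1 * gx 2)) = 2 * fps_X * K * (qx 1 * qx 2)"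
proof (rule fps_dd_eqI)
  have "fps_map (s_gen 0) (K * (gx 1 * gx 2)) = K * (geom (- Var 1) * geom (- Var 2))"
    using assms s_gen_Var(3,4) by (simp add: fps_map_s_gen mult_ac)
  then have "K * (gx 1 * gx 2) - fps_map (s_gen 0) (K * (gx 1 * gx 2))
      = K * (gx 1 * gx 2 - geom (- Var 1) * geom (- Var 2))"
    by (simp add: right_diff_distrib)
  also have "\<dots> = fps_const (root_form 0) * (2 * fps_X * K * (qx 1 * qx 2))"
    unfolding geom_prod_diff by (simp add: root_form_def mult_ac)
  finally show "fps_const (root_form 0) * (2 * fps_X * K * (qx 1 * qx 2))
      = K * (gx 1 * gx 2) - fps_map (s_gen 0) (K * (gx 1 * gx 2))" by simp
qed

lemma dd_qx_gx:
  assumes "i \<noteq> 0" "fps_map (s_gen i) K = K"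
  shows "fps_map (dd i) (K * (qx i * gx (Suc i))) = - fps_X * K * (qx i * qx (Suc i))"
proof (rule fps_dd_eqI)
  have "K * (qx i * gx (Suc i)) - fps_map (s_gen i) (K * (qx i * gx (Suc i)))
      = K * gx i * gx (Suc i) * (geom (- Var i) - geom (- Var (Suc i)))"
    using assms by (simp add: fps_map_s_gen s_gen_Var algebra_simps)
  also have "\<dots> = fps_const (root_form i) * (- fps_X * K * (qx i * qx (Suc i)))"
    using assms(1) unfolding geom_diff by (simp add: root_form_def algebra_simps flip: fps_const_sub)
  finally show "fps_const (root_form i) * (- fps_X * K * (qx i * qx (Suc i)))
      = K * (qx i * gx (Suc i)) - fps_map (s_gen i) (K * (qx i * gx (Suc i)))" by simp
qed

lemma fps_map_dds_append: "fps_map (dds (L @ L')) F = fps_map (dds L') (fps_map (dds L) F)"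
  by (rule fps_ext) simp

lemma fps_map_dds_single: "fps_map (dds [i]) F = fps_map (dd i) F"
  by (rule fps_ext) simp

lemma s_gen_outside:
  assumes "\<And>j. j \<in> A \<Longrightarrow> j \<noteq> i \<and> j \<noteq> Suc i \<and> (i = 0 \<longrightarrow> j \<noteq> 2)"
  shows "fps_map (s_gen i) (\<Prod>j\<in>A. gx j) = (\<Prod>j\<in>A. gx j)"
    and "fps_map (s_gen i) (\<Prod>j\<in>A. qx j) = (\<Prod>j\<in>A. qx j)"
  using assms by (auto simp: fps_map_s_gen s_gen_Var(5) intro!: prod.cong)

lemma dds_down:
  assumes "1 \<le> k" "k \<le> n"
  shows "fps_map (dds (rev [k..<n])) (gx n) = (- fps_X) ^ (n - k) * (\<Prod>j=k..n. gx j)"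
  using assms(2,1)
proof (induction rule: inc_induct)
  case base
  show ?case by (rule fps_ext) simp
next
  case (step k)
  let ?K = "(- fps_X) ^ (n - Suc k) * (\<Prod>j=Suc (Suc k)..n. gx j)"
  have "fps_map (dds (rev [k..<n])) (gx n) = fps_map (dd k) (fps_map (dds (rev [Suc k..<n])) (gx n))"
    using step.hyps by (simp add: upt_rec[of k] fps_map_dds_append fps_map_dds_single)
  also have "\<dots> = fps_map (dd k) (?K * gx (Suc k))"
    using step by (simp add: prod.atLeast_Suc_atMost[of "Suc k"] mult_ac)
  also have "\<dots> = - fps_X * ?K * (gx k * gx (Suc k))"
  proof (rule dd_gx)
    have "fps_map (s_gen k) (\<Prod>j=Suc (Suc k)..n. gx j) = (\<Prod>j=Suc (Suc k)..n. gx j)"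
      using step.prems by (intro s_gen_outside) auto
    then show "fps_map (s_gen k) ?K = ?K" by (simp only: fps_map_s_gen(4,5,6,9))
  qed (use step.prems in simp)
  also have "\<dots> = (- fps_X) ^ Suc (n - Suc k) * (gx k * (gx (Suc k) * (\<Prod>j=Suc (Suc k)..n. gx j)))"
    by (simp only: power_Suc mult_ac)
  also have "gx k * (gx (Suc k) * (\<Prod>j=Suc (Suc k)..n. gx j)) = (\<Prod>j=k..n. gx j)"
    using step.hyps by (simp add: prod.atLeast_Suc_atMost)
  finally show ?case using step.hyps by (simp add: Suc_diff_Suc)
qed

lemma dds_up:
  assumes "2 \<le> k" "k \<le> n" "\<And>i. fps_map (s_gen i) K = K"
  shows "fps_map (dds [2..<k]) (K * (qx 1 * qx 2) * (\<Prod>j=3..n. gx j))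
    = K * (- fps_X) ^ (k - 2) * (\<Prod>j=1..k. qx j) * (\<Prod>j=Suc k..n. gx j)"
  using assms(1,2)
proof (induction rule: dec_induct)
  case base
  have "{1..2::nat} = {1, 2}" by auto
  then show ?case by (intro fps_ext) (simp add: mult_ac numeral_3_eq_3)
next
  case (step k)
  let ?K = "K * (- fps_X) ^ (k - 2) * (\<Prod>j=1..k-1. qx j) * (\<Prod>j=Suc (Suc k)..n. gx j)"
  have k: "k = Suc (k - 1)" using step.hyps by simp
  have prod_k: "(\<Prod>j=1..k. qx j) = (\<Prod>j=1..k-1. qx j) * qx k"
    by (subst k, subst prod.nat_ivl_Suc') (use k in \<open>auto simp: mult_ac\<close>)
  have "fps_map (dds [2..<Suc k]) (K * (qx 1 * qx 2) * (\<Prod>j=3..n. gx j))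
      = fps_map (dd k) (fps_map (dds [2..<k]) (K * (qx 1 * qx 2) * (\<Prod>j=3..n. gx j)))"
    using step.hyps by (simp add: fps_map_dds_append fps_map_dds_single)
  also have "\<dots> = fps_map (dd k) (?K * (qx k * gx (Suc k)))"
    using step unfolding prod_k by (simp add: prod.atLeast_Suc_atMost[of "Suc k"] mult_ac)
  also have "\<dots> = - fps_X * ?K * (qx k * qx (Suc k))"
  proof (rule dd_qx_gx)
    have "fps_map (s_gen k) (\<Prod>j=1..k-1. qx j) = (\<Prod>j=1..k-1. qx j)"
      "fps_map (s_gen k) (\<Prod>j=Suc (Suc k)..n. gx j) = (\<Prod>j=Suc (Suc k)..n. gx j)"
      using step.hyps by (intro s_gen_outside; auto)+
    then show "fps_map (s_gen k) ?K = ?K" by (simp only: fps_map_s_gen(4,5,6,9) assms(3))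
  qed (use step.hyps in simp)
  also have "\<dots> = K * (- fps_X) ^ Suc (k - 2) * (((\<Prod>j=1..k-1. qx j) * qx k) * qx (Suc k))
      * (\<Prod>j=Suc (Suc k)..n. gx j)"
    by (simp only: power_Suc mult_ac)
  also have "((\<Prod>j=1..k-1. qx j) * qx k) * qx (Suc k) = (\<Prod>j=1..Suc k. qx j)"
    unfolding prod_k[symmetric] by (subst prod.nat_ivl_Suc') (auto simp: mult_ac)
  also have "Suc (k - 2) = Suc k - 2" using step.hyps by simp
  finally show ?case .
qed

text \<open>A reduced word of length \<open>2n - 2\<close> for the longest of the minimal coset representatives of
  \<open>W\<^sub>n / W\<^sub>n\<^sub>-\<^sub>1\<close>.\<close>

definition coset_word :: "nat \<Rightarrow> nat list" where
  "coset_word n = rev [1..<n] @ [0] @ [2..<n]"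

lemma coset_word_length_letters:
  assumes "n \<ge> 2"
  shows "length (coset_word n) = 2 * n - 2" "set (coset_word n) \<subseteq> {..<n}"
  using assms by (auto simp: coset_word_def)

text \<open>The letters \<open>n - 1, \<dots>, 1\<close> turn \<open>1/(1 - x\<^sub>n t)\<close> into \<open>(-t)\<^sup>n\<^sup>-\<^sup>1 / \<Prod> (1 - x\<^sub>j t)\<close>. The letter 0 gives a
  factor \<open>2t\<close> and replaces the first two factors of the denominator by \<open>1 - x\<^sub>j\<^sup>2 t\<^sup>2\<close>; each of the
  letters \<open>2, \<dots>, n - 1\<close> gives a factor \<open>-t\<close> and replaces one more. The coefficient of
  \<open>t\<^sup>2\<^sup>n\<^sup>-\<^sup>2\<close> of the result is its leading one.\<close>

lemma dds_coset_word_power: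
  assumes "n \<ge> 2"
  shows "dds (coset_word n) (Var n ^ (2 * n - 2)) = - 2"
proof -
  let ?K = "(- fps_X) ^ (n - 1) * (\<Prod>j=3..n. gx j)" and ?K' = "2 * fps_X * (- fps_X) ^ (n - 1) :: gamma mpoly fps"
  have split: "(\<Prod>j=1..n. gx j) = (gx 1 * gx 2) * (\<Prod>j=3..n. gx j)"
    using assms by (simp add: prod.atLeast_Suc_atMost numeral_2_eq_2 numeral_3_eq_3 mult_ac)
  have "fps_map (dds (coset_word n)) (gx n)
      = fps_map (dds [2..<n]) (fps_map (dd 0) ((- fps_X) ^ (n - 1) * (\<Prod>j=1..n. gx j)))"
    using assms by (simp only: coset_word_def fps_map_dds_append fps_map_dds_single dds_down)
  also have "(- fps_X) ^ (n - 1) * (\<Prod>j=1..n. gx j) = ?K * (gx 1 * gx 2)"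
    unfolding split by (simp only: mult_ac)
  also have "fps_map (dd 0) (?K * (gx 1 * gx 2)) = 2 * fps_X * ?K * (qx 1 * qx 2)"
  proof (rule dd_box_gx)
    have "fps_map (s_gen 0) (\<Prod>j=3..n. gx j) = (\<Prod>j=3..n. gx j)" by (rule s_gen_outside) auto
    then show "fps_map (s_gen 0) ?K = ?K" by (simp only: fps_map_s_gen(4,5,6,9))
  qed
  also have "\<dots> = ?K' * (qx 1 * qx 2) * (\<Prod>j=3..n. gx j)" by (simp only: mult_ac)
  also have "fps_map (dds [2..<n]) \<dots> = ?K' * (- fps_X) ^ (n - 2) * (\<Prod>j=1..n. qx j)
      * (\<Prod>j=Suc n..n. gx j)"
    using assms by (intro dds_up) (simp_all only: fps_map_s_gen(4,5,6,8,9))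
  also have "\<dots> = - (fps_X ^ (2 * n - 2) * (2 * (\<Prod>j=1..n. qx j)))"
  proof -
    obtain k where n: "n = k + 2" using assms by (metis add.commute le_iff_add)
    have "(- fps_X) ^ (k + 1) * (- fps_X) ^ k = (- fps_X :: gamma mpoly fps) ^ (2 * k + 1)"
      by (simp only: mult_2 add_ac flip: power_add)
    also have "\<dots> = - (fps_X ^ (2 * k + 1))" by (rule power_minus_odd) simp
    finally have pow: "fps_X * ((- fps_X) ^ (k + 1) * (- fps_X) ^ k)
        = - (fps_X ^ (2 * k + 2) :: gamma mpoly fps)"
      by simp
    have "?K' * (- fps_X) ^ (n - 2) * (\<Prod>j=1..n. qx j) * (\<Prod>j=Suc n..n. gx j)
        = (fps_X * ((- fps_X) ^ (k + 1) * (- fps_X) ^ k)) * (2 * (\<Prod>j=1..n. qx j))"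
      by (simp add: n mult_ac)
    then show ?thesis unfolding pow by (simp add: n)
  qed
  finally have "dds (coset_word n) (fps_nth (gx n) (2 * n - 2))
      = fps_nth (- (fps_X ^ (2 * n - 2) * (2 * (\<Prod>j=1..n. qx j)))) (2 * n - 2)"
    by (metis fps_map_nth)
  also have "\<dots> = - 2 * fps_nth (\<Prod>j=1..n. qx j) 0"
    by (simp add: fps_X_power_mult_nth)
  also have "fps_nth (\<Prod>j\<in>A. qx j) 0 = 1" for A
    by (induction A rule: infinite_finite_induct) (simp_all add: geom_def)
  finally show ?thesis by (simp add: geom_def)
qed


section \<open>Generating series of the eta polynomials\<close>

definition e_series :: "nat set \<Rightarrow> gamma mpoly fps" where
  "e_series A = (\<Prod>i\<in>A. 1 + fps_const (Var i) * fps_X)"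

definition b_series :: "gamma mpoly fps" where
  "b_series = Abs_fps (\<lambda>k. Const (gamma_b k))"

definition t_series :: "nat \<Rightarrow> gamma mpoly fps" where
  "t_series n = b_series * e_series {1..n}"

definition d_series :: "nat \<Rightarrow> gamma mpoly fps" where
  "d_series n = (2 * b_series - 1) * e_series {1..n}"

lemma d_series_eq: "d_series n = 2 * t_series n - e_series {1..n}"
  by (simp add: d_series_def t_series_def algebra_simps)

lemma fps_nth_lin_mult:
  "fps_nth (F * (1 + fps_const x * fps_X)) (Suc k) = fps_nth F (Suc k) + x * fps_nth (F :: 'a::comm_ring_1 fps) k"
proof -
  have "F * (1 + fps_const x * fps_X) = F + fps_const x * (fps_X * F)" by (simp add: algebra_simps)
  then show ?thesis by simp
qed

lemma e_series_eq_0: "finite A \<Longrightarrow> card A < k \<Longrightarrow> fps_nth (e_series A) k = 0"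
proof (induction A arbitrary: k rule: finite_induct)
  case (insert i A)
  then obtain k' where k: "k = Suc k'" by (cases k) auto
  have "e_series (insert i A) = e_series A * (1 + fps_const (Var i) * fps_X)"
    using insert by (simp add: e_series_def mult.commute)
  then show ?case using insert unfolding k by (simp only: fps_nth_lin_mult) simp
qed (simp add: e_series_def)

lemma e_series_0: "fps_nth (e_series A) 0 = 1"
  unfolding e_series_def by (induction A rule: infinite_finite_induct) simp_all

lemma e_series_nth: "fps_nth (e_series {1..n}) j = elem_sym n j"
proof -
  have "e_series {1..n} = (\<Prod>i\<in>{1..n}. fps_const (Var i) * fps_X + 1)"
    by (simp add: e_series_def add.commute)
  also have "\<dots> = (\<Sum>A\<in>Pow {1..n}. \<Prod>i\<in>A. fps_const (Var i) * fps_X)"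
    by (subst prod_add) simp_all
  also have "fps_nth \<dots> j = (\<Sum>A\<in>Pow {1..n}. if card A = j then \<Prod>i\<in>A. Var i else 0)"
    unfolding fps_sum_nth
  proof (intro sum.cong refl)
    fix A :: "nat set"
    have const: "(\<Prod>i\<in>A. fps_const (Var i)) = fps_const (\<Prod>i\<in>A. Var i :: gamma mpoly)"
      by (induction A rule: infinite_finite_induct) (simp_all flip: fps_const_mult)
    show "fps_nth (\<Prod>i\<in>A. fps_const (Var i) * fps_X) j
        = (if card A = j then \<Prod>i\<in>A. Var i else (0 :: gamma mpoly))"
      by (simp add: prod.distrib const fps_X_power_nth)
  qed
  also have "\<dots> = elem_sym n j"
    unfolding elem_sym_def by (subst sum.inter_filter[symmetric]) (auto intro: sum.cong)
  finally show ?thesis .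
qed

lemmas e_series_nth' = e_series_nth[unfolded One_nat_def]

lemma t_series_nth: "fps_nth (t_series n) p = (\<Sum>j\<le>p. Const (gamma_b (p - j)) * elem_sym n j)"
  unfolding t_series_def mult.commute[of b_series] fps_mult_nth e_series_nth atLeast0AtMost
  by (intro sum.cong) (simp_all add: b_series_def mult.commute)

lemma t_series_split:
  "fps_nth (t_series n) p = (\<Sum>j<p. Const (gamma_b (p - j)) * elem_sym n j) + elem_sym n p"
  unfolding t_series_nth lessThan_Suc_atMost[symmetric] sum.lessThan_Suc
  by (simp add: gamma_b_0 Const_one)

lemma two_fps_nth: "fps_nth (2 * F) p = 2 * fps_nth (F :: 'a::comm_ring_1 fps) p"
  unfolding mult_2 by (rule fps_add_nth)

lemma eta_b_series:
  "eta_b n p = (if p < n then fps_nth (d_series n) p else fps_nth (t_series n) p)"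
proof (cases "p < n")
  case True
  then show ?thesis
    by (simp add: eta_b_def d_series_eq two_fps_nth t_series_split e_series_nth')
next
  case False
  then show ?thesis by (simp add: eta_b_def t_series_nth)
qed

lemma eta_b'_series: "eta_b' n = fps_nth (t_series n) n - fps_nth (e_series {1..n}) n"
  by (simp add: eta_b'_def t_series_split e_series_nth')

lemma series_Suc:
  "e_series {1..Suc m} = e_series {1..m} * (1 + fps_const (Var (Suc m)) * fps_X)"
  "t_series (Suc m) = t_series m * (1 + fps_const (Var (Suc m)) * fps_X)"
  "d_series (Suc m) = d_series m * (1 + fps_const (Var (Suc m)) * fps_X)"
  by (simp_all add: e_series_def t_series_def d_series_def prod.nat_ivl_Suc' mult_ac)

lemma series_Suc_nth:
  "fps_nth (e_series {1..Suc m}) (Suc p)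
    = fps_nth (e_series {1..m}) (Suc p) + Var (Suc m) * fps_nth (e_series {1..m}) p"
  "fps_nth (t_series (Suc m)) (Suc p)
    = fps_nth (t_series m) (Suc p) + Var (Suc m) * fps_nth (t_series m) p"
  "fps_nth (d_series (Suc m)) (Suc p)
    = fps_nth (d_series m) (Suc p) + Var (Suc m) * fps_nth (d_series m) p"
  by (simp_all only: series_Suc fps_nth_lin_mult)

lemma d_series_0: "fps_nth (d_series m) 0 = 1"
  by (simp add: d_series_def b_series_def gamma_b_0 Const_one e_series_0 two_fps_nth)


subsection \<open>Invariance\<close>

lemma s_act_series:
  assumes "1 \<le> i" "i < n"
  shows "fps_map (s_gen i) b_series = b_series" "fps_map (s_gen i) (e_series {1..n}) = e_series {1..n}"
proof -
  show "fps_map (s_gen i) b_series = b_series"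
    using assms by (intro fps_ext) (simp add: b_series_def s_gen_def s_act_values)
  have "transpose i (i + 1) permutes {1..n}" using assms by (intro permutes_swap_id) auto
  from prod.permute[OF this, of "\<lambda>j. 1 + fps_const (Var j) * fps_X :: gamma mpoly fps"]
  show "fps_map (s_gen i) (e_series {1..n}) = e_series {1..n}"
    using assms by (simp add: e_series_def fps_map_s_gen)
      (simp add: s_gen_def s_act_values comp_def)
qed

lemma s_box_b_series:
  "fps_map (s_gen 0) b_series
    = b_series + fps_const (Var 1 + Var 2) * (fps_X * ((gx 1 * gx 2) * (2 * b_series - 1)))"
proof (rule fps_ext)
  fix p
  have c: "fps_nth (2 * b_series - 1) k = Const (c_of gamma_b k)" for k
  proof (cases "k = 0")
    case True
    then show ?thesis by (simp add: b_series_def two_fps_nth gamma_b_0 Const_one c_of_def)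
  next
    case False
    have "Const (2 * gamma_b k) = 2 * Const (gamma_b k)"
      by (simp only: Const_mult ring_homD(12)[OF is_ring_hom_Const])
    with False show ?thesis by (simp add: b_series_def two_fps_nth c_of_def)
  qed
  show "fps_nth (fps_map (s_gen 0) b_series) p = fps_nth (b_series
      + fps_const (Var 1 + Var 2) * (fps_X * ((gx 1 * gx 2) * (2 * b_series - 1)))) p"
  proof (cases p)
    case 0
    have "s_gen 0 1 = 1" by (rule ring_homD(2)[OF is_ring_hom_s_gen])
    then show ?thesis using 0 by (simp add: b_series_def gamma_b_0 Const_one)
  next
    case (Suc k)
    have "fps_nth ((gx 1 * gx 2) * (2 * b_series - 1)) k
        = (\<Sum>j<Suc k. (\<Sum>a\<le>j. Var 1 ^ a * Var 2 ^ (j - a)) * Const (c_of gamma_b (k - j)))"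
      unfolding fps_mult_nth[of "gx 1 * gx 2"] c
      by (simp only: fps_mult_nth geom_def fps_nth_Abs_fps lessThan_Suc_atMost atMost_atLeast0)
    moreover have "s_gen 0 (Const (gamma_b (Suc k))) = Const (gamma_b (Suc k)) + (Var 1 + Var 2) *
        (\<Sum>j<Suc k. (\<Sum>a\<le>j. Var 1 ^ a * Var 2 ^ (j - a)) * Const (c_of gamma_b (k - j)))"
      using s_box_act_values(5)[of "Suc k"] by (simp add: s_gen_def)
    moreover have "fps_nth (A + fps_const r * (fps_X * Z)) (Suc k) = fps_nth A (Suc k) + r * fps_nth Z k"
      for A Z :: "gamma mpoly fps" and r by simp
    ultimately show ?thesis unfolding Suc fps_map_nth by (simp add: b_series_def)
  qed
qed

text \<open>With \<open>u = x\<^sub>1 + x\<^sub>2\<close> and \<open>F\<close> the product of the factors \<open>1 + x\<^sub>j t\<close> for \<open>j \<ge> 3\<close>, the generator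
  \<open>s\<^sub>\<box>\<close> subtracts \<open>u t F\<close> from the series \<open>\<Sum> b\<^sub>p t\<^sup>p \<cdot> \<Prod> (1 + x\<^sub>j t)\<close> and twice that from
  \<open>\<Prod> (1 + x\<^sub>j t)\<close>. As \<open>u t F\<close> has degree below \<open>n\<close>, all coefficients from the \<open>n\<close>-th on are
  invariant, and in \<open>C(t) \<Prod> (1 + x\<^sub>j t)\<close> the two changes cancel.\<close>

lemma s_box_series:
  assumes "n \<ge> 2"
  defines "w \<equiv> fps_const (Var 1 + Var 2) * (fps_X * e_series {3..n})"
  shows "fps_map (s_gen 0) (t_series n) = t_series n - w"
    and "fps_map (s_gen 0) (e_series {1..n}) = e_series {1..n} - 2 * w"
proof -
  let ?u = "fps_const (Var 1 + Var 2) * fps_X :: gamma mpoly fps"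
  let ?P = "(1 - fps_const (Var 1) * fps_X) * (1 - fps_const (Var 2) * fps_X) :: gamma mpoly fps"
  let ?F = "e_series {3..n}"
  have E: "e_series {1..n} = (1 + fps_const (Var 1) * fps_X) * (1 + fps_const (Var 2) * fps_X) * ?F"
    using assms(1) by (simp add: e_series_def prod.atLeast_Suc_atMost numeral_2_eq_2 numeral_3_eq_3 mult_ac)
  also have "(1 + fps_const (Var 1) * fps_X) * (1 + fps_const (Var 2) * fps_X) = ?P + 2 * ?u"
    by (simp add: algebra_simps flip: fps_const_add)
  finally have EP: "e_series {1..n} = ?P * ?F + 2 * (?u * ?F)"
    by (simp add: distrib_right mult.assoc)
  have F: "fps_map (s_gen 0) ?F = ?F"
    by (auto simp: e_series_def fps_map_s_gen s_gen_Var(5) intro!: prod.cong)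
  have sE: "fps_map (s_gen 0) (e_series {1..n}) = ?P * ?F"
    unfolding E using s_gen_Var(3,4)
    by (simp add: fps_map_s_gen F mult_ac flip: fps_const_neg)
  then show "fps_map (s_gen 0) (e_series {1..n}) = e_series {1..n} - 2 * w"
    unfolding EP w_def by (simp add: algebra_simps)
  have "?P * (gx 1 * gx 2) = ((1 - fps_const (Var 1) * fps_X) * gx 1) * ((1 - fps_const (Var 2) * fps_X) * gx 2)"
    by (simp only: mult_ac)
  then have P: "?P * (gx 1 * gx 2) = 1" by (simp only: geom_inverse mult_1)
  have expand: "(b + u * (G * Z)) * (P * F) = b * (P * F) + u * ((P * G) * Z) * F"
    for b u G Z P F :: "gamma mpoly fps" by (simp add: algebra_simps)
  have "fps_map (s_gen 0) (t_series n)
      = (b_series + ?u * ((gx 1 * gx 2) * (2 * b_series - 1))) * (?P * ?F)"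
    unfolding t_series_def by (simp only: fps_map_s_gen(5) s_box_b_series sE mult.assoc)
  also have "\<dots> = b_series * (?P * ?F) + ?u * ((?P * (gx 1 * gx 2)) * (2 * b_series - 1)) * ?F"
    by (simp only: expand)
  also have "\<dots> = b_series * (?P * ?F + 2 * (?u * ?F)) - ?u * ?F"
    unfolding P by (simp add: algebra_simps)
  finally show "fps_map (s_gen 0) (t_series n) = t_series n - w"
    unfolding t_series_def EP w_def by (simp only: mult.assoc)
qed

lemma s_gen_series_nth:
  assumes "i < n" "n \<ge> 2"
  shows "s_gen i (fps_nth (d_series n) p) = fps_nth (d_series n) p"
    and "p \<ge> n \<Longrightarrow> s_gen i (fps_nth (t_series n) p) = fps_nth (t_series n) p"
    and "p \<ge> n \<Longrightarrow> s_gen i (fps_nth (e_series {1..n}) p) = fps_nth (e_series {1..n}) p"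
proof -
  let ?w = "fps_const (Var 1 + Var 2) * (fps_X * e_series {3..n}) :: gamma mpoly fps"
  have w: "fps_nth ?w p = 0" if p: "p \<ge> n" for p
  proof -
    obtain k where k: "p = Suc k" using p assms by (cases p) auto
    have "fps_nth (e_series {3..n}) k = 0" using p assms k by (intro e_series_eq_0) auto
    then show ?thesis unfolding k by simp
  qed
  have d: "fps_map (s_gen i) (d_series n) = d_series n
      \<and> (p \<ge> n \<longrightarrow> fps_nth (fps_map (s_gen i) (t_series n)) p = fps_nth (t_series n) p)
      \<and> (p \<ge> n \<longrightarrow> fps_nth (fps_map (s_gen i) (e_series {1..n})) p = fps_nth (e_series {1..n}) p)"
  proof (cases "i = 0")
    case True
    have "fps_map (s_gen 0) (d_series n) = 2 * (t_series n - ?w) - (e_series {1..n} - 2 * ?w)"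
      by (simp only: d_series_eq fps_map_s_gen(3,5,8) s_box_series[OF assms(2)])
    also have "\<dots> = d_series n" by (simp add: d_series_eq algebra_simps)
    finally show ?thesis
      using w unfolding True s_box_series[OF assms(2)] fps_sub_nth two_fps_nth by simp
  next
    case False
    then have "1 \<le> i" by simp
    from s_act_series[OF this assms(1)] show ?thesis
      by (simp only: d_series_def t_series_def fps_map_s_gen(1,3,5,8)) simp
  qed
  then have "fps_nth (fps_map (s_gen i) (d_series n)) p = fps_nth (d_series n) p" by simp
  then show "s_gen i (fps_nth (d_series n) p) = fps_nth (d_series n) p" by simp
  show "p \<ge> n \<Longrightarrow> s_gen i (fps_nth (t_series n) p) = fps_nth (t_series n) p"
    "p \<ge> n \<Longrightarrow> s_gen i (fps_nth (e_series {1..n}) p) = fps_nth (e_series {1..n}) p"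
    using d by simp_all
qed


subsection \<open>The quadratic relation\<close>

lemma b_relation_Const: "p \<ge> 1 \<Longrightarrow> b_relation (\<lambda>i. Const (gamma_b i)) p = 0"
proof -
  assume "p \<ge> 1"
  then have "abs_gamma (b_relation free_b p) = 0"
    using b_ideal_props(6) by (simp add: zero_gamma_def gamma.abs_eq_iff)
  then have "Const (abs_gamma (b_relation free_b p)) = 0" by (simp add: Const_def)
  then show ?thesis
    using ring_hom_b_relation[OF ring_hom_comp[OF is_ring_hom_Const is_ring_hom_abs_gamma], of free_b p]
    by (simp add: gamma_b.abs_eq)
qed

lemma neg_arg_pairing:
  fixes F G :: "'a::comm_ring_1 fps"
  shows "fps_nth (F * fps_neg_arg G) (2 * m) = (-1) ^ m * (fps_nth F m * fps_nth G m
    + (\<Sum>i=1..m. (-1) ^ i * (fps_nth F (m + i) * fps_nth G (m - i) + fps_nth F (m - i) * fps_nth G (m + i))))"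
proof -
  let ?f = "\<lambda>j. fps_nth F j * ((-1) ^ (2 * m - j) * fps_nth G (2 * m - j))"
  have "fps_nth (F * fps_neg_arg G) (2 * m) = (\<Sum>j=0..2*m. ?f j)"
    by (simp add: fps_mult_nth fps_neg_arg_def)
  also have "\<dots> = ?f m + (\<Sum>i=1..m. ?f (m + i) + ?f (m - i))" by (rule sum_about_middle)
  also have "(\<Sum>i=1..m. ?f (m + i) + ?f (m - i)) = (\<Sum>i=1..m. (-1) ^ m * ((-1) ^ i *
      (fps_nth F (m + i) * fps_nth G (m - i) + fps_nth F (m - i) * fps_nth G (m + i))))"
  proof (intro sum.cong refl)
    fix i assume "i \<in> {1..m}"
    then have i: "2 * m - (m + i) = m - i" "2 * m - (m - i) = m + i"
      and sum: "m + i = (m - i) + 2 * i" by auto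
    have "(-1 :: 'a) ^ (m + i) = (-1) ^ (m - i) * ((-1) ^ 2) ^ i"
      unfolding sum by (simp only: power_add power_mult)
    then have "(-1 :: 'a) ^ (m - i) = (-1) ^ (m + i)" by simp
    then show "?f (m + i) + ?f (m - i) = (-1) ^ m * ((-1) ^ i *
      (fps_nth F (m + i) * fps_nth G (m - i) + fps_nth F (m - i) * fps_nth G (m + i)))"
      unfolding i by (simp add: power_add algebra_simps)
  qed
  also have "?f m = (-1) ^ m * (fps_nth F m * fps_nth G m)" by (simp add: algebra_simps)
  finally show ?thesis by (simp add: distrib_left sum_distrib_left)
qed

lemma b_series_neg_arg: "fps_nth (b_series * fps_neg_arg b_series) (2 * p) = fps_nth b_series (2 * p)"
proof (cases "p = 0")
  case True
  then show ?thesis by (simp add: b_series_def fps_neg_arg_def gamma_b_0 Const_one)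
next
  case False
  let ?b = "\<lambda>i. Const (gamma_b i) :: gamma mpoly"
  have "{1..p} = insert p {1..p-1}" using False by auto
  then have "(\<Sum>i=1..p. (-1) ^ i * (?b (p + i) * ?b (p - i) + ?b (p - i) * ?b (p + i)))
      = (-1) ^ p * (2 * ?b (2 * p))
        + (\<Sum>i=1..p-1. (-1) ^ i * (?b (p + i) * ?b (p - i) + ?b (p - i) * ?b (p + i)))"
    using False by (simp add: gamma_b_0 Const_one flip: mult_2)
  also have "(\<Sum>i=1..p-1. (-1) ^ i * (?b (p + i) * ?b (p - i) + ?b (p - i) * ?b (p + i)))
      = 2 * (\<Sum>i=1..p-1. (-1) ^ i * ?b (p + i) * ?b (p - i))"
    unfolding sum_distrib_left by (intro sum.cong) (simp_all add: algebra_simps)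
  finally have "?b p * ?b p + (\<Sum>i=1..p. (-1) ^ i * (?b (p + i) * ?b (p - i) + ?b (p - i) * ?b (p + i)))
      = b_relation ?b p + (-1) ^ p * ?b (2 * p)"
    by (simp add: b_relation_def power2_eq_square algebra_simps)
  also have "\<dots> = (-1) ^ p * ?b (2 * p)" using b_relation_Const[of p] False by simp
  finally show ?thesis
    unfolding neg_arg_pairing by (simp add: b_series_def left_minus_one_mult_self)
qed

lemma e_series_neg_arg_odd: "odd k \<Longrightarrow> fps_nth (e_series A * fps_neg_arg (e_series A)) k = 0"
proof (induction A arbitrary: k rule: infinite_finite_induct)
  case (insert i A)
  let ?W = "e_series A * fps_neg_arg (e_series A)" and ?x = "Var i :: gamma mpoly"
  have ins: "e_series (insert i A) = (1 + fps_const ?x * fps_X) * e_series A"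
    using insert by (simp add: e_series_def)
  have "e_series (insert i A) * fps_neg_arg (e_series (insert i A))
      = ?W * (1 + fps_const ?x * fps_X) * (1 + fps_const (- ?x) * fps_X)"
    unfolding ins fps_neg_arg_mult fps_neg_arg_lin by (simp only: mult_ac)
  also have "\<dots> = ?W - fps_const (?x ^ 2) * (fps_X ^ 2 * ?W)"
    by (simp add: algebra_simps power2_eq_square flip: fps_const_neg fps_const_mult)
  finally show ?case
    using insert by (simp add: fps_X_power_mult_nth)
qed (auto simp: e_series_def fps_neg_arg_one elim: oddE)

text \<open>The relations of \<open>\<Gamma>'\<close> say that the even coefficients of \<open>B(t) B(-t)\<close> are those of
  \<open>B(t) = \<Sum> b\<^sub>p t\<^sup>p\<close>. After multiplication with the even series \<open>E(t) E(-t)\<close>, this says that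
  \<open>T(t) T(-t)\<close> and \<open>T(t) E(-t)\<close> have the same even coefficients, where \<open>T = B E\<close>. Unlike
  \<open>C(t) C(-t) = 1\<close>, this form of the relations involves no division.\<close>

lemma eta_quadratic_relation:
  "fps_nth (t_series m) m * eta_b' m
    = - (\<Sum>i=1..m. (-1) ^ i * (fps_nth (t_series m) (m + i) * fps_nth (d_series m) (m - i)))"
proof -
  let ?T = "t_series m" and ?E = "e_series {1..m}"
  let ?W = "?E * fps_neg_arg ?E"
  have "?T * fps_neg_arg ?T = (b_series * fps_neg_arg b_series) * ?W" "?T * fps_neg_arg ?E = b_series * ?W"
    by (simp_all only: t_series_def fps_neg_arg_mult mult_ac)
  moreover have "fps_nth ((b_series * fps_neg_arg b_series) * ?W) (2 * m) = fps_nth (b_series * ?W) (2 * m)"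
    unfolding fps_mult_nth[of _ ?W]
  proof (intro sum.cong refl)
    fix j assume j: "j \<in> {0..2 * m}"
    show "fps_nth (b_series * fps_neg_arg b_series) j * fps_nth ?W (2 * m - j)
        = fps_nth b_series j * fps_nth ?W (2 * m - j)"
    proof (cases "even j")
      case True
      then show ?thesis using b_series_neg_arg by (auto elim: evenE)
    next
      case False
      then have "odd (2 * m - j)" using j by simp
      then show ?thesis by (simp add: e_series_neg_arg_odd)
    qed
  qed
  ultimately have "fps_nth (?T * fps_neg_arg ?T - ?T * fps_neg_arg ?E) (2 * m) = 0" by simp
  also have "?T * fps_neg_arg ?T - ?T * fps_neg_arg ?E = ?T * fps_neg_arg (?T - ?E)"
    by (rule fps_ext) (simp add: fps_mult_nth fps_neg_arg_def algebra_simps sum_subtractf)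
  finally have "(-1) ^ m * (fps_nth ?T m * fps_nth (?T - ?E) m + (\<Sum>i=1..m. (-1) ^ i *
      (fps_nth ?T (m + i) * fps_nth (?T - ?E) (m - i) + fps_nth ?T (m - i) * fps_nth (?T - ?E) (m + i)))) = 0"
    (is "_ * ?s = 0") unfolding neg_arg_pairing .
  then have "(-1) ^ m * ((-1) ^ m * ?s) = 0" by simp
  then have "?s = 0" by (simp only: left_minus_one_mult_self)
  moreover have "(\<Sum>i=1..m. (-1) ^ i * (fps_nth ?T (m + i) * fps_nth (?T - ?E) (m - i)
        + fps_nth ?T (m - i) * fps_nth (?T - ?E) (m + i)))
      = (\<Sum>i=1..m. (-1) ^ i * (fps_nth ?T (m + i) * fps_nth (d_series m) (m - i)))"
  proof (intro sum.cong refl)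
    fix i assume "i \<in> {1..m}"
    then have e: "fps_nth ?E (m + i) = 0" by (intro e_series_eq_0) auto
    have d: "fps_nth (d_series m) (m - i) = 2 * fps_nth ?T (m - i) - fps_nth ?E (m - i)"
      by (simp only: d_series_eq fps_sub_nth two_fps_nth)
    show "(-1) ^ i * (fps_nth ?T (m + i) * fps_nth (?T - ?E) (m - i)
        + fps_nth ?T (m - i) * fps_nth (?T - ?E) (m + i))
      = (-1) ^ i * (fps_nth ?T (m + i) * fps_nth (d_series m) (m - i))"
      unfolding d fps_sub_nth e by (simp add: algebra_simps)
  qed
  ultimately show ?thesis by (simp add: eta_b'_series eq_neg_iff_add_eq_0)
qed


section \<open>Adjoining the other variables\<close>

text \<open>With all variables outside \<open>{1..n}\<close> adjoined to the eta polynomials of level \<open>n\<close>, the rings for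
  different \<open>n\<close> lie in one ambient ring and decrease with \<open>n\<close>. This permits an induction on \<open>n\<close>
  that never splits a polynomial into its coefficients with respect to a variable.\<close>

definition eta_ext_gens :: "nat \<Rightarrow> gamma mpoly set" where
  "eta_ext_gens n = insert (eta_b' n) (eta_b n ` {1..}) \<union> Var ` (- {1..n})"

abbreviation eta_ext :: "nat \<Rightarrow> gamma mpoly set" where
  "eta_ext n \<equiv> subring_gen (eta_ext_gens n)"

lemma eta_ext_mem:
  shows "p < n \<Longrightarrow> fps_nth (d_series n) p \<in> eta_ext n"
    and "1 \<le> p \<Longrightarrow> n \<le> p \<Longrightarrow> fps_nth (t_series n) p \<in> eta_ext n"
    and "eta_b' n \<in> eta_ext n"
    and "j \<notin> {1..n} \<Longrightarrow> Var j \<in> eta_ext n"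
    and "1 \<le> n \<Longrightarrow> fps_nth (e_series {1..n}) n \<in> eta_ext n"
proof -
  have eta: "eta_b n p \<in> eta_ext n" if "1 \<le> p" for p
    using that by (intro subring_gen.gen) (auto simp: eta_ext_gens_def)
  show "fps_nth (d_series n) p \<in> eta_ext n" if "p < n"
    using that eta[of p] subring_gen.one by (cases "p = 0") (auto simp: d_series_0 eta_b_series)
  show t: "fps_nth (t_series n) p \<in> eta_ext n" if "1 \<le> p" "n \<le> p" for p
    using that eta[of p] by (simp add: eta_b_series)
  show eta': "eta_b' n \<in> eta_ext n" by (intro subring_gen.gen) (auto simp: eta_ext_gens_def)
  show "Var j \<in> eta_ext n" if "j \<notin> {1..n}"
    using that by (intro subring_gen.gen) (auto simp: eta_ext_gens_def)
  show "fps_nth (e_series {1..n}) n \<in> eta_ext n" if "1 \<le> n"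
    using subring_gen.diff[OF t[OF that order_refl] eta'] by (simp add: eta_b'_series)
qed

lemma eta_ext_invariant:
  assumes "n \<ge> 2" "i < n" "f \<in> eta_ext n"
  shows "s_gen i f = f"
proof -
  have "s_gen i f = id f"
  proof (rule ring_hom_eq_on_subring_gen[OF is_ring_hom_s_gen is_ring_hom_id _ assms(3)])
    fix s assume "s \<in> eta_ext_gens n"
    then consider "s = eta_b' n" | p where "p \<ge> 1" "s = eta_b n p" | j where "j \<notin> {1..n}" "s = Var j"
      by (auto simp: eta_ext_gens_def)
    then show "s_gen i s = id s"
    proof cases
      case 3
      then show ?thesis using assms by (auto intro!: s_gen_Var(5))
    qed (use s_gen_series_nth[OF assms(2,1)]
        in \<open>auto simp: eta_b'_series eta_b_series ring_homD[OF is_ring_hom_s_gen]\<close>)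
  qed
  then show ?thesis by simp
qed

lemma eta_ext_1: "f \<in> eta_ext 1"
proof -
  have t: "fps_nth (t_series 1) (Suc p) = Const (gamma_b (Suc p)) + Var 1 * Const (gamma_b p)" for p
    using series_Suc_nth(2)[of 0 p] by (simp add: t_series_def e_series_def b_series_def)
  have "elem_sym 1 0 = 1"
    using e_series_nth[of 1 0] e_series_0 by simp
  then have b1: "eta_b' 1 = Const (gamma_b 1)" by (simp add: eta_b'_def)
  have "fps_nth (t_series 1) 1 - eta_b' 1 \<in> eta_ext 1"
    by (intro subring_gen.diff eta_ext_mem) simp_all
  then have x: "Var 1 \<in> eta_ext 1" using t[of 0] b1 by (simp add: gamma_b_0 Const_one)
  have b: "Const (gamma_b p) \<in> eta_ext 1" for p
  proof (induction p)
    case 0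
    show ?case by (simp add: gamma_b_0 Const_one subring_gen.one)
  next
    case (Suc p)
    have "fps_nth (t_series 1) (Suc p) - Var 1 * Const (gamma_b p) \<in> eta_ext 1"
      by (intro subring_gen.diff subring_gen.mult eta_ext_mem x Suc) simp_all
    then show ?case unfolding t by (simp only: add_diff_cancel_right')
  qed
  show ?thesis
  proof (rule subring_gen_least[OF gamma_mpoly_generated])
    have "Var j \<in> eta_ext 1" for j using x eta_ext_mem(4)[of j 1] by (cases "j = 1") auto
    with b show "range Var \<union> (\<lambda>p. Const (gamma_b p)) ` {1..} \<subseteq> eta_ext 1" by auto
  qed
qed


section \<open>Generators of one level over the next\<close>

definition powers :: "'a::comm_ring_1 \<Rightarrow> nat \<Rightarrow> 'a set" where
  "powers x k = (\<lambda>i. x ^ i) ` {..<k}"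

definition powers2 :: "'a::comm_ring_1 \<Rightarrow> 'a \<Rightarrow> nat \<Rightarrow> 'a set" where
  "powers2 x y k = powers x k \<union> (\<lambda>g. y * g) ` powers x k"

lemma powers_mono: "k \<le> l \<Longrightarrow> powers x k \<subseteq> powers x l"
  by (auto simp: powers_def)

lemma powers_mem: "i < k \<Longrightarrow> x ^ i \<in> powers x k"
  by (simp add: powers_def)

lemma one_in_powers: "k \<ge> 1 \<Longrightarrow> 1 \<in> powers x k"
  using powers_mem[of 0 k x] by simp

lemma self_in_powers: "k \<ge> 2 \<Longrightarrow> x \<in> powers x k"
  using powers_mem[of 1 k x] by simp

lemma span_powers2:
  assumes "f \<in> lin_span (subring_gen S) (powers x k)" "k \<le> l"
  shows "f \<in> lin_span (subring_gen S) (powers2 x y l)" "y * f \<in> lin_span (subring_gen S) (powers2 x y l)"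
proof -
  have f: "f \<in> lin_span (subring_gen S) (powers x l)"
    using lin_span_mono[OF assms(1) powers_mono[OF assms(2)]] .
  show "f \<in> lin_span (subring_gen S) (powers2 x y l)"
    using lin_span_mono[OF f] by (simp add: powers2_def)
  show "y * f \<in> lin_span (subring_gen S) (powers2 x y l)"
    by (rule lin_span_mult_left[OF f]) (auto simp: powers2_def intro: lin_span_base)
qed

lemma span_powers_mult:
  assumes "f \<in> lin_span (subring_gen S) (powers x k)" "g \<in> lin_span (subring_gen S) (powers x l)"
    "k + l \<le> Suc r"
  shows "f * g \<in> lin_span (subring_gen S) (powers x r)"
proof (rule lin_span_mult[OF assms(1,2)])
  fix u v assume "u \<in> powers x k" "v \<in> powers x l"
  then obtain i j where "u = x ^ i" "v = x ^ j" "i < k" "j < l" by (auto simp: powers_def)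
  then show "u * v \<in> lin_span (subring_gen S) (powers x r)"
    using assms(3) by (intro lin_span_base) (auto simp: powers_def simp flip: power_add)
qed

lemma span_powers_shift:
  assumes "f \<in> lin_span (subring_gen S) (powers x k)"
  shows "x * f \<in> lin_span (subring_gen S) (powers x (Suc k))"
  by (rule span_powers_mult[of x S x 2 f k])
    (use assms in \<open>auto simp: powers_def intro!: lin_span_base image_eqI[of _ _ 1]\<close>)

lemma span_powers2_shift:
  assumes "f \<in> lin_span (subring_gen S) (powers2 x y k)"
  shows "x * f \<in> lin_span (subring_gen S) (powers2 x y (Suc k))"
proof (rule lin_span_mult_left[OF assms])
  fix g assume "g \<in> powers2 x y k"
  then obtain i where "i < k" "g = x ^ i \<or> g = y * x ^ i" by (auto simp: powers2_def powers_def)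
  then have "x * g = x ^ Suc i \<or> x * g = y * x ^ Suc i" "Suc i < Suc k" by (auto simp: mult_ac)
  then show "x * g \<in> lin_span (subring_gen S) (powers2 x y (Suc k))"
    by (intro lin_span_base) (auto simp: powers2_def powers_def simp del: power_Suc)
qed

lemma span_powers_neg_power:
  assumes "i < k"
  shows "(- x) ^ i \<in> lin_span (subring_gen S) (powers x k)"
  unfolding power_minus[of x i] using assms
  by (intro lin_span_term) (auto simp: powers_def intro: subring_gen_intros)

context
  fixes m n :: nat and x y :: "gamma mpoly"
  assumes m: "m \<ge> 1" and n_def: "n = Suc m" and x_def: "x = Var (Suc m)" and y_def: "y = eta_b' m"
begin

text \<open>The series of level \<open>n\<close> arise from those of level \<open>m = n - 1\<close> by the factor \<open>1 + x t\<close>. Solving for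
  level \<open>m\<close> expresses its generators over level \<open>n\<close> by powers of \<open>x\<close> and by \<open>y\<close>; what matters of
  these expressions is their leading power of \<open>x\<close>.\<close>

lemma d_lead:
  "p \<le> m \<Longrightarrow> fps_nth (d_series m) p - (- x) ^ p \<in> lin_span (eta_ext n) (powers x p)"
proof (induction p)
  case 0
  then show ?case by (simp add: d_series_0 lin_span.zero)
next
  case (Suc p)
  have "fps_nth (d_series n) (Suc p) \<in> eta_ext n"
    using Suc.prems by (intro eta_ext_mem) (simp add: n_def)
  from lin_span_term[OF this one_in_powers[of "Suc p" x]]
  have "fps_nth (d_series n) (Suc p) \<in> lin_span (eta_ext n) (powers x (Suc p))" by simp
  then have "fps_nth (d_series n) (Suc p) - x * (fps_nth (d_series m) p - (- x) ^ p)
      \<in> lin_span (eta_ext n) (powers x (Suc p))"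
    using Suc.IH Suc.prems by (intro lin_span_diff[OF _ span_powers_shift]) auto
  then show ?case by (simp add: n_def x_def series_Suc_nth algebra_simps)
qed

lemma d_span:
  assumes "p \<le> m"
  shows "fps_nth (d_series m) p \<in> lin_span (eta_ext n) (powers x (Suc p))"
  using lin_span_add[OF lin_span_mono[OF d_lead[OF assms] powers_mono[of p "Suc p" x]]
      span_powers_neg_power[of p "Suc p" x]] by simp

lemma y_eq: "y = fps_nth (d_series m) m - fps_nth (t_series m) m"
  "fps_nth (d_series m) m - 2 * y = fps_nth (e_series {1..m}) m"
proof -
  have d: "fps_nth (d_series m) m = 2 * fps_nth (t_series m) m - fps_nth (e_series {1..m}) m"
    by (simp only: d_series_eq fps_sub_nth two_fps_nth)
  show "y = fps_nth (d_series m) m - fps_nth (t_series m) m"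
    "fps_nth (d_series m) m - 2 * y = fps_nth (e_series {1..m}) m"
    unfolding d y_def eta_b'_series by (simp_all add: algebra_simps)
qed

lemma t_lead:
  "fps_nth (t_series m) (m + Suc i) - (- x) ^ Suc i * y \<in> lin_span (eta_ext n) (powers x (Suc i))"
proof (induction i)
  case 0
  have e: "fps_nth (e_series {1..m}) (Suc m) = 0" by (intro e_series_eq_0) auto
  have "eta_b' n = fps_nth (t_series m) (m + Suc 0) - (- x) ^ Suc 0 * y"
    unfolding y_def eta_b'_series n_def series_Suc_nth e x_def
    by (simp add: algebra_simps)
  moreover have "eta_b' n * 1 \<in> lin_span (eta_ext n) (powers x (Suc 0))"
    by (intro lin_span_term eta_ext_mem one_in_powers) simp
  ultimately show ?case by simp
next
  case (Suc i)
  have "fps_nth (t_series n) (m + Suc (Suc i)) * 1 \<in> lin_span (eta_ext n) (powers x (Suc (Suc i)))"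
    by (intro lin_span_term eta_ext_mem one_in_powers) (auto simp: n_def)
  then have "fps_nth (t_series n) (m + Suc (Suc i)) * 1
      - x * (fps_nth (t_series m) (m + Suc i) - (- x) ^ Suc i * y)
      \<in> lin_span (eta_ext n) (powers x (Suc (Suc i)))"
    using Suc.IH by (intro lin_span_diff[OF _ span_powers_shift]) auto
  then show ?case using series_Suc_nth(2)[of m "m + Suc i"] by (simp add: n_def x_def algebra_simps)
qed

text \<open>The product \<open>x\<^sub>1 \<dots> x\<^sub>n\<close> is the difference of \<open>\<^sup>nb\<^sub>n\<close> and \<open>\<^sup>nb'\<^sub>n\<close>.\<close>

lemma e_top: "x * fps_nth (e_series {1..m}) m \<in> eta_ext n"
proof -
  have "fps_nth (e_series {1..m}) (Suc m) = 0" by (intro e_series_eq_0) auto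
  then have "fps_nth (e_series {1..n}) n = x * fps_nth (e_series {1..m}) m"
    unfolding n_def series_Suc_nth x_def by simp
  then show ?thesis using eta_ext_mem(5)[of n] by (simp add: n_def)
qed

abbreviation M :: "nat \<Rightarrow> gamma mpoly set" where
  "M k \<equiv> lin_span (eta_ext n) (powers2 x y k)"

text \<open>In \<open>y\<^sup>2 = y d\<^sub>m + \<Sum> (-1)\<^sup>i t\<^sub>m\<^sub>+\<^sub>i d\<^sub>m\<^sub>-\<^sub>i\<close> the products \<open>y d\<^sub>m\<close> and
  \<open>t\<^sub>m\<^sub>+\<^sub>i d\<^sub>m\<^sub>-\<^sub>i\<close> are all \<open>y (-x)\<^sup>m\<close> up to lower terms; the alternating signs leave this once if \<open>m\<close> is even and cancel it if \<open>m\<close> is odd.\<close>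

lemma y_square: "y * y - (if even m then y * (- x) ^ m else 0) \<in> M m"
proof -
  have "y * y = y * fps_nth (d_series m) m - fps_nth (t_series m) m * y"
    by (subst (2) y_eq(1)) (simp add: algebra_simps)
  also have "fps_nth (t_series m) m * y
      = - (\<Sum>i=1..m. (-1) ^ i * (fps_nth (t_series m) (m + i) * fps_nth (d_series m) (m - i)))"
    unfolding y_def by (rule eta_quadratic_relation)
  finally have sq: "y * y = y * fps_nth (d_series m) m
      + (\<Sum>i=1..m. (-1) ^ i * (fps_nth (t_series m) (m + i) * fps_nth (d_series m) (m - i)))"
    by simp
  have lead: "(-1) ^ i * (fps_nth (t_series m) (m + i) * fps_nth (d_series m) (m - i) - y * (- x) ^ m) \<in> M m"
    if i: "i \<in> {1..m}" for i
  proof -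
    let ?t = "fps_nth (t_series m) (m + i)" and ?d = "fps_nth (d_series m) (m - i)"
    obtain i' where i': "i = Suc i'" using i by (cases i) auto
    have "(?t - (- x) ^ i * y) * ?d \<in> lin_span (eta_ext n) (powers x m)"
      using t_lead[of i'] i i' by (intro span_powers_mult[OF _ d_span]) auto
    then have 1: "(?t - (- x) ^ i * y) * ?d \<in> M m" by (rule span_powers2(1)) simp
    have "(- x) ^ i * (?d - (- x) ^ (m - i)) \<in> lin_span (eta_ext n) (powers x m)"
      using i by (intro span_powers_mult[OF span_powers_neg_power[of i "Suc i"] d_lead]) auto
    then have 2: "y * ((- x) ^ i * (?d - (- x) ^ (m - i))) \<in> M m" by (rule span_powers2(2)) simp
    have "(- x) ^ m = (- x) ^ i * (- x) ^ (m - i)" using i by (simp flip: power_add)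
    then have "?t * ?d - y * (- x) ^ m
        = (?t - (- x) ^ i * y) * ?d + y * ((- x) ^ i * (?d - (- x) ^ (m - i)))"
      by (simp add: algebra_simps)
    then show ?thesis using lin_span_add[OF 1 2]
      by (auto intro!: lin_span_scale subring_gen_intros)
  qed
  have "(\<Sum>i=1..k. (-1) ^ i) = (if even k then 0 else (-1 :: gamma mpoly))" for k
    by (induction k) auto
  then have "(\<Sum>i=1..m. (-1) ^ i * (y * (- x) ^ m)) = (if even m then 0 else - (y * (- x) ^ m))"
    by (simp flip: sum_distrib_right)
  then have "y * y - (if even m then y * (- x) ^ m else 0) = y * (fps_nth (d_series m) m - (- x) ^ m)
      + (\<Sum>i=1..m. (-1) ^ i * (fps_nth (t_series m) (m + i) * fps_nth (d_series m) (m - i) - y * (- x) ^ m))"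
    unfolding sq by (simp add: right_diff_distrib sum_subtractf)
  moreover have "y * (fps_nth (d_series m) m - (- x) ^ m) \<in> M m"
    by (rule span_powers2(2)[OF d_lead]) simp_all
  ultimately show ?thesis using lead by (auto intro!: lin_span_add lin_span_sum)
qed

text \<open>These are the two products that leave the range of exponents. Both memberships follow from
  \<open>x d\<^sub>m - 2 x y = e\<^sub>n\<close> with \<open>d\<^sub>m = (-x)\<^sup>m + \<dots>\<close>. For the second, the term
  \<open>2 x y\<^sup>2\<close> contributes \<open>2 y x (-x)\<^sup>m\<close> again when \<open>m\<close> is even; the leading coefficient then is
  \<open>1 - 2 = -1\<close> instead of 1.\<close>

lemma top_powers: "x * x ^ m \<in> M n" "y * (x * x ^ m) \<in> M n"
proof -
  let ?e = "x * fps_nth (e_series {1..m}) m" and ?a = "fps_nth (d_series m) m - (- x) ^ m"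
  let ?z = "y * (x * (- x) ^ m)"
  have sign: "x * x ^ m = (-1) ^ m * (x * (- x) ^ m)"
    by (simp add: power_minus[of x m] left_minus_one_mult_self mult_ac)
  have R: "(-1) ^ m \<in> eta_ext n" by (intro subring_gen_intros)
  have a: "x * ?a \<in> lin_span (eta_ext n) (powers x n)"
    unfolding n_def by (intro span_powers_shift d_lead[unfolded n_def]) simp
  have base: "1 \<in> lin_span (eta_ext n) (powers x n)" "x \<in> lin_span (eta_ext n) (powers x n)"
    using m by (auto simp: n_def intro!: lin_span_base one_in_powers self_in_powers)
  have e: "?e * 1 \<in> lin_span (eta_ext n) (powers x n)"
    by (intro lin_span_scale e_top base)
  have eq: "x * (- x) ^ m = ?e * 1 + 2 * (y * x) - x * ?a"
    unfolding y_eq(2)[symmetric] by (simp add: algebra_simps)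
  have two: "2 \<in> eta_ext n" by (rule subring_gen_numeral)
  have "?e * 1 + 2 * (y * x) - x * ?a \<in> M n"
    by (intro lin_span_add lin_span_diff lin_span_scale[OF two] span_powers2[OF base(2)]
        span_powers2[OF e] span_powers2[OF a]) simp_all
  then have "x * (- x) ^ m \<in> M n" unfolding eq .
  from lin_span_scale[OF R this] show "x * x ^ m \<in> M n" unfolding sign .
  let ?s = "if even m then y * (- x) ^ m else 0"
  have sq: "x * (y * y - ?s) \<in> M n" unfolding n_def by (rule span_powers2_shift[OF y_square[unfolded n_def]])
  have z: "?z = y * (?e * 1) + 2 * (x * (y * y)) - y * (x * ?a)"
    by (subst eq) (simp only: algebra_simps)
  have "y * (?e * 1) + 2 * (x * (y * y - ?s)) - y * (x * ?a) \<in> M n"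
    by (intro lin_span_add lin_span_diff lin_span_scale[OF two] span_powers2[OF e] span_powers2[OF a] sq)
      simp_all
  moreover have "y * (?e * 1) + 2 * (x * (y * y - ?s)) - y * (x * ?a) = (if even m then - ?z else ?z)"
  proof -
    have "y * (?e * 1) + 2 * (x * (y * y - ?s)) - y * (x * ?a) = ?z - 2 * (x * ?s)"
      unfolding z by (simp add: right_diff_distrib)
    also have "\<dots> = (if even m then - ?z else ?z)" by (simp add: mult_ac)
    finally show ?thesis .
  qed
  ultimately have "(if even m then - ?z else ?z) \<in> M n" by simp
  then have "?z \<in> M n" using lin_span_uminus[of "- ?z"] by (auto split: if_splits)
  from lin_span_scale[OF R this] show "y * (x * x ^ m) \<in> M n"
    unfolding sign by (simp only: mult.left_commute)
qed

lemma x_mult_M: "f \<in> M n \<Longrightarrow> x * f \<in> M n"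
proof (erule lin_span_mult_left)
  fix g assume "g \<in> powers2 x y n"
  then obtain i where i: "i \<le> m" "g = x ^ i \<or> g = y * x ^ i"
    by (auto simp: powers2_def powers_def n_def less_Suc_eq_le)
  show "x * g \<in> M n"
  proof (cases "i = m")
    case True
    then show ?thesis using i top_powers by (auto simp: mult.left_commute[of x y])
  next
    case False
    then have "x ^ Suc i \<in> powers x n" using i by (intro powers_mem) (auto simp: n_def)
    then have "x ^ Suc i \<in> lin_span (eta_ext n) (powers x n)" by (rule lin_span_base)
    from span_powers2[OF this order_refl] i show ?thesis by (auto simp: mult.left_commute[of x y])
  qed
qed

lemma x_power_mult_M: "f \<in> M n \<Longrightarrow> x ^ i * f \<in> M n"
  by (induction i) (auto simp: mult.assoc intro: x_mult_M)

lemma y_mult_M: "f \<in> M n \<Longrightarrow> y * f \<in> M n"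
proof (erule lin_span_mult_left)
  fix g assume "g \<in> powers2 x y n"
  then obtain i where i: "i < n" "g = x ^ i \<or> g = y * x ^ i"
    by (auto simp: powers2_def powers_def)
  then have "x ^ i \<in> lin_span (eta_ext n) (powers x n)"
    by (intro lin_span_base) (auto simp: powers_def)
  then have 1: "y * x ^ i \<in> M n" by (rule span_powers2(2)) simp
  have "(- x) ^ m \<in> lin_span (eta_ext n) (powers x n)"
    by (rule span_powers_neg_power) (simp add: n_def)
  then have "y * (- x) ^ m \<in> M n" by (rule span_powers2(2)) simp
  moreover have "y * y - (if even m then y * (- x) ^ m else 0) \<in> M n"
    by (rule lin_span_mono[OF y_square]) (auto simp: powers2_def powers_def n_def)
  ultimately have "y * y \<in> M n"
    using lin_span_add[of "y * y - y * (- x) ^ m" _ _ "y * (- x) ^ m"] by (auto split: if_splits)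
  from x_power_mult_M[OF this, of i] 1 i show "y * g \<in> M n" by (auto simp: mult_ac)
qed

lemma M_mult: "f \<in> M n \<Longrightarrow> g \<in> M n \<Longrightarrow> f * g \<in> M n"
proof (erule lin_span_mult)
  fix u v assume u: "u \<in> powers2 x y n" and v: "v \<in> powers2 x y n"
  have v: "v \<in> M n" using v by (rule lin_span_base)
  obtain i where "u = x ^ i \<or> u = y * x ^ i" using u by (auto simp: powers2_def powers_def)
  with x_power_mult_M[OF v, of i] y_mult_M[OF x_power_mult_M[OF v, of i]]
  show "u * v \<in> M n" by (auto simp: mult.assoc)
qed

text \<open>The span is a ring, and it contains the generators of level \<open>m\<close>.\<close>

lemma eta_ext_span: "f \<in> eta_ext m \<Longrightarrow> f \<in> M n"
proof (rule subring_gen_subset_lin_span[of "eta_ext_gens m" _ "eta_ext_gens n"])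
  have "1 \<in> powers2 x y n" by (auto simp: powers2_def n_def intro: one_in_powers)
  then show one: "1 \<in> M n" by (auto intro: lin_span_base)
  fix s g assume s: "s \<in> eta_ext_gens m" and g: "g \<in> powers2 x y n"
  from s consider "s = y" | p where "p \<ge> 1" "s = eta_b m p" | j where "j \<notin> {1..m}" "s = Var j"
    by (auto simp: eta_ext_gens_def y_def)
  then have "s \<in> M n"
  proof cases
    case 1
    then show ?thesis using y_mult_M[OF one] by simp
  next
    case 2
    consider "p < m" | "p = m" | i where "p = m + Suc i"
      by (metis less_iff_Suc_add linorder_neqE_nat add_Suc_right)
    then show ?thesis
    proof cases
      case 1
      then have "fps_nth (d_series m) p \<in> M n" by (intro span_powers2(1)[OF d_span]) (auto simp: n_def)
      then show ?thesis using 1 2 by (simp add: eta_b_series)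
    next
      case 2
      have "fps_nth (d_series m) m \<in> M n" by (intro span_powers2(1)[OF d_span]) (auto simp: n_def)
      from lin_span_diff[OF this y_mult_M[OF one]] y_eq(1) have "fps_nth (t_series m) m \<in> M n" by simp
      then show ?thesis using \<open>s = eta_b m p\<close> 2 by (simp add: eta_b_series)
    next
      case (3 i)
      have y: "y \<in> M n" using y_mult_M[OF one] by simp
      have x: "(- x) ^ Suc i * y \<in> M n"
        unfolding power_minus[of x "Suc i"] mult.assoc
        by (intro lin_span_scale x_power_mult_M y subring_gen_intros)
      have "fps_nth (t_series m) (m + Suc i) - (- x) ^ Suc i * y \<in> M n"
      proof (rule subsetD[OF _ t_lead])
        show "lin_span (eta_ext n) (powers x (Suc i)) \<subseteq> M n"
        proof
          fix f assume "f \<in> lin_span (eta_ext n) (powers x (Suc i))"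
          then have "f * 1 \<in> M n"
            by (rule lin_span_mult[where H = "{1}"])
              (use x_power_mult_M[OF one] in \<open>auto simp: powers_def intro: lin_span_base\<close>)
          then show "f \<in> M n" by simp
        qed
      qed
      from lin_span_add[OF this x] show ?thesis using \<open>s = eta_b m p\<close> 3 by (simp add: eta_b_series)
    qed
  next
    case 3
    show ?thesis
    proof (cases "j = Suc m")
      case True
      then show ?thesis using x_mult_M[OF one] 3 by (simp add: x_def)
    next
      case False
      then have "Var j * 1 \<in> M n" using 3 by (intro lin_span_scale one eta_ext_mem) (auto simp: n_def)
      then show ?thesis using 3 by simp
    qed
  qed
  then show "s * g \<in> M n" using g by (intro M_mult) (auto intro: lin_span_base)
qed


section \<open>The descent from one level to the next\<close>

lemma degree_le_y: "degree_le m y"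
proof -
  have elem: "degree_le j (elem_sym m j)" for j
    unfolding elem_sym_def
  proof (intro degree_le_sum)
    fix A assume A: "A \<in> {A. A \<subseteq> {1..m} \<and> card A = j}"
    have "finite A \<Longrightarrow> degree_le (card A) (\<Prod>i\<in>A. Var i)" for A :: "nat set"
    proof (induction rule: finite_induct)
      case (insert i A)
      then show ?case using degree_le.mult[OF degree_le.Var[of i] insert.IH] by simp
    qed (simp add: degree_le.one)
    then show "degree_le j (\<Prod>i\<in>A. Var i)" using A finite_subset[of A "{1..m}"] by auto
  qed
  show ?thesis
    unfolding y_def eta_b'_def
  proof (intro degree_le_sum)
    fix j assume "j \<in> {..<m}"
    then show "degree_le m (Const (gamma_b (m - j)) * elem_sym m j)"
      using degree_le.mult[OF degree_le.b[of "m - j"] elem[of j]] by simp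
  qed
qed

lemma of_int_gamma_mpoly_inj: "(of_int k :: gamma mpoly) = of_int l \<Longrightarrow> k = l"
proof -
  assume "(of_int k :: gamma mpoly) = of_int l"
  then have "Poly_Mapping.lookup (of_int k :: gamma mpoly) 0 = Poly_Mapping.lookup (of_int l :: gamma mpoly) 0"
    by (rule arg_cong)
  then have "abs_gamma (of_int k) = abs_gamma (of_int l)"
    by (simp add: lookup_of_int ring_homD[OF is_ring_hom_abs_gamma])
  then have diff: "of_int k - of_int l \<in> b_ideal" by (simp add: gamma.abs_eq_iff)
  let ?h = "mpoly_eval id (\<lambda>_. 0) :: int mpoly \<Rightarrow> int"
  have h: "is_ring_hom ?h" by (intro is_ring_hom_mpoly_eval is_ring_hom_id)
  have "?h (b_relation free_b p) = 0" if "p \<ge> 1" for p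
  proof -
    have "?h (b_relation free_b p) = b_relation (\<lambda>i. ?h (free_b i)) p"
      by (rule ring_hom_b_relation[OF h])
    also have "\<dots> = b_relation (\<lambda>_. 0) p"
      using that by (intro b_relation_cong) (auto simp: free_b_def mpoly_eval_Var is_ring_hom_id)
    finally show ?thesis by (simp add: b_relation_def)
  qed
  from ring_hom_b_ideal[OF h this diff] have "?h (of_int k - of_int l) = 0" .
  then show "k = l" by (simp only: ring_homD[OF h]) simp
qed

lemma word_length_letters: "length (coset_word n) = 2 * m" "i \<in> set (coset_word n) \<Longrightarrow> i < n"
  using m coset_word_length_letters[of n] by (auto simp: n_def)

lemma dds_low: "degree_le d f \<Longrightarrow> d < 2 * m \<Longrightarrow> dds (coset_word n) f = 0"
  using dds_degree[of d f "coset_word n"] word_length_letters(1) by simp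

lemma dds_top: "degree_le (2 * m) f \<Longrightarrow> \<exists>k. dds (coset_word n) f = of_int k"
  using dds_degree[of "2 * m" f "coset_word n"] word_length_letters(1) degree_le_0 by simp

lemma dds_linear:
  "a \<in> eta_ext n \<Longrightarrow> dds (coset_word n) (a * f) = a * dds (coset_word n) f"
  using m word_length_letters(2) by (intro dds_invariant_mult eta_ext_invariant[of n]) (auto simp: n_def)

lemma degree_le_x: "degree_le i (x ^ i)"
  unfolding x_def by (rule degree_le_Var_power)

text \<open>The generators \<open>x\<^sup>i\<close> and \<open>y x\<^sup>i\<close> with \<open>i \<le> m\<close> have degree at most \<open>2m\<close>, which is the length of the
  word, so that their images are integers.\<close>

lemma dds_eta_ext: "f \<in> eta_ext m \<Longrightarrow> dds (coset_word n) f \<in> eta_ext n"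
proof -
  assume "f \<in> eta_ext m"
  then have "f \<in> M n" by (rule eta_ext_span)
  then show ?thesis
  proof induction
    case zero
    show ?case by (simp add: subring_gen_zero)
  next
    case (step f a g)
    then obtain i where i: "i < n" "g = x ^ i \<or> g = y * x ^ i" by (auto simp: powers2_def powers_def)
    have "degree_le (2 * m) g"
      using i degree_le.mono[OF degree_le_x[of i]] degree_le.mono[OF degree_le.mult[OF degree_le_y degree_le_x[of i]]]
      by (auto simp: n_def)
    from dds_top[OF this] have "dds (coset_word n) g \<in> eta_ext n" by (auto intro: subring_gen_of_int)
    then show ?case
      using step by (auto simp: dds_add dds_linear intro: subring_gen_add subring_gen.mult)
  qed
qed

text \<open>Twice the value is computed from \<open>2 y = d\<^sub>m - e\<^sub>m\<close>, where only the power \<open>x\<^sup>2\<^sup>m\<close> survives for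
  degree reasons. The value itself is an integer, again by its degree, and integers can be
  divided by 2 because \<open>\<Gamma>'\<close> has characteristic 0.\<close>

lemma dds_unit: "\<exists>k. dds (coset_word n) (y * x ^ m) = of_int k \<and> k * k = 1"
proof -
  let ?D = "dds (coset_word n)"
  have "degree_le (2 * m) (y * x ^ m)"
    using degree_le.mult[OF degree_le_y degree_le_x[of m]] by (simp add: mult_2)
  then obtain k where k: "?D (y * x ^ m) = of_int k" using dds_top by blast
  let ?a = "fps_nth (d_series m) m - (- x) ^ m"
  have "x ^ m = x * x ^ (m - 1)" using m by (cases m) auto
  then have shift: "(x * z) * x ^ (m - 1) = z * x ^ m" for z by (simp only: mult_ac)
  have "2 * (y * x ^ m) = (fps_nth (d_series m) m) * x ^ m
      - (x * (fps_nth (d_series m) m - 2 * y)) * x ^ (m - 1)"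
    unfolding shift by (simp add: algebra_simps)
  also have "\<dots> = (-1) ^ m * x ^ (2 * m) + ?a * x ^ m
      + (- (x * fps_nth (e_series {1..m}) m)) * x ^ (m - 1)"
  proof -
    have "(- x) ^ m * x ^ m = (-1) ^ m * x ^ (2 * m)"
      by (simp add: power_minus[of x m] mult.assoc mult_2 power_add)
    then show ?thesis unfolding y_eq(2) by (simp add: algebra_simps)
  qed
  finally have "?D (2 * (y * x ^ m)) = ?D ((-1) ^ m * x ^ (2 * m)) + ?D (?a * x ^ m)
      + ?D ((- (x * fps_nth (e_series {1..m}) m)) * x ^ (m - 1))"
    by (simp only: dds_add)
  also have "?D ((-1) ^ m * x ^ (2 * m)) = (-1) ^ m * (- 2)"
    using dds_coset_word_power[of n] m
    by (subst dds_linear) (auto simp: n_def x_def intro: subring_gen_intros)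
  also have "?D (?a * x ^ m) = 0"
    using d_lead[OF order_refl]
  proof induction
    case (step f a g)
    then obtain i where i: "i < m" "g = x ^ i" by (auto simp: powers_def)
    have "?D (x ^ (i + m)) = 0" using i by (intro dds_low[OF degree_le_x]) simp
    then show ?case
      using step i by (simp add: distrib_right mult.assoc dds_add dds_linear power_add)
  qed simp
  also have "?D ((- (x * fps_nth (e_series {1..m}) m)) * x ^ (m - 1)) = 0"
    using m dds_low[OF degree_le_x[of "m - 1"]] subring_gen_uminus[OF e_top] by (subst dds_linear) auto
  also have "?D (2 * (y * x ^ m)) = 2 * of_int k"
    by (subst dds_linear) (auto simp: k intro: subring_gen_numeral)
  finally have "(of_int (2 * k) :: gamma mpoly) = of_int ((-1) ^ m * (- 2))" by simp
  then have "2 * k = (-1) ^ m * (- 2)" by (rule of_int_gamma_mpoly_inj)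
  then have "k = - ((-1) ^ m)" by simp
  then have "k * k = 1" by (simp add: minus_one_mult_self)
  with k show ?thesis by blast
qed

text \<open>The composite \<open>\<Phi>\<close> of the divided differences is linear over invariants, so that
  \<open>\<Phi> (f y x\<^sup>m) = \<plusminus> f\<close>, whereas \<open>\<Phi>\<close> maps all of level \<open>m\<close> into level \<open>n\<close>.\<close>

lemma descent:
  assumes f: "f \<in> eta_ext m" and inv: "\<And>i. i < n \<Longrightarrow> s_gen i f = f"
  shows "f \<in> eta_ext n"
proof -
  obtain k where k: "dds (coset_word n) (y * x ^ m) = of_int k" "k * k = 1"
    using dds_unit by blast
  have "y \<in> eta_ext m" "x \<in> eta_ext m" unfolding y_def x_def by (auto intro: eta_ext_mem)
  then have "dds (coset_word n) (f * (y * x ^ m)) \<in> eta_ext n"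
    using f by (intro dds_eta_ext subring_gen_intros)
  moreover have "dds (coset_word n) (f * (y * x ^ m)) = f * of_int k"
    using inv word_length_letters(2) k by (subst dds_invariant_mult) auto
  ultimately have "f * of_int k \<in> eta_ext n" by simp
  from subring_gen.mult[OF this subring_gen_of_int[of k]]
  have "f * of_int k * of_int k \<in> eta_ext n" .
  moreover have "f * of_int k * of_int k = f"
    using k(2) by (simp add: mult.assoc flip: of_int_mult)
  ultimately show ?thesis by simp
qed

end

lemma invariant_in_eta_ext:
  assumes "n \<ge> 1" "\<And>i. i < n \<Longrightarrow> s_gen i f = f"
  shows "f \<in> eta_ext n"
  using assms
proof (induction n rule: nat_induct_at_least)
  case base
  show ?case by (rule eta_ext_1)
next
  case (Suc n)
  then show ?case by (intro descent[OF _ refl refl refl]) auto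
qed


section \<open>Removing the other variables\<close>

text \<open>A retraction onto \<open>\<Gamma>'[X\<^sub>n]\<close>, which undoes the adjunction of variables.\<close>

definition drop_vars :: "nat \<Rightarrow> gamma mpoly \<Rightarrow> gamma mpoly" where
  "drop_vars n = mpoly_eval Const (\<lambda>j. if j \<in> {1..n} then Var j else 0)"

lemma is_ring_hom_drop_vars: "is_ring_hom (drop_vars n)"
  unfolding drop_vars_def by (intro is_ring_hom_mpoly_eval is_ring_hom_Const)

lemma drop_vars_poly_X:
  assumes "f \<in> poly_X n"
  shows "drop_vars n f = f"
proof -
  have "drop_vars n f = mpoly_eval Const Var f"
    using assms unfolding drop_vars_def mpoly_eval_def mon_eval_def poly_X_def
    by (intro sum.cong prod.cong refl arg_cong2[of _ _ _ _ "(*)"]) fastforce+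
  then show ?thesis by (simp add: mpoly_eval_id)
qed

lemma poly_X_closed:
  "1 \<in> poly_X n" "Const a \<in> poly_X n" "j \<in> {1..n} \<Longrightarrow> Var j \<in> poly_X n"
  "f \<in> poly_X n \<Longrightarrow> g \<in> poly_X n \<Longrightarrow> f - g \<in> poly_X n"
  "f \<in> poly_X n \<Longrightarrow> g \<in> poly_X n \<Longrightarrow> f * g \<in> poly_X n"
proof -
  show "1 \<in> poly_X n" "Const a \<in> poly_X n" "j \<in> {1..n} \<Longrightarrow> Var j \<in> poly_X n"
    by (simp_all add: poly_X_def Const_def Var_def)
  assume f: "f \<in> poly_X n" and g: "g \<in> poly_X n"
  show "f - g \<in> poly_X n"
    using f g keys_diff[of f g] by (auto simp: poly_X_def)
  show "f * g \<in> poly_X n"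
    unfolding poly_X_def
  proof (intro CollectI ballI)
    fix k assume "k \<in> Poly_Mapping.keys (f * g)"
    then obtain a c where "k = a + c" "a \<in> Poly_Mapping.keys f" "c \<in> Poly_Mapping.keys g"
      using keys_mult[of f g] by blast
    then show "Poly_Mapping.keys k \<subseteq> {1..n}"
      using f g keys_add[of a c] by (fastforce simp: poly_X_def)
  qed
qed

lemma eta_gens_poly_X:
  "insert (eta_b' n) (eta_b n ` {1..}) \<subseteq> subring_gen (range Const \<union> Var ` {1..n})"
proof -
  let ?P = "subring_gen (range Const \<union> Var ` {1..n}) :: gamma mpoly set"
  have const: "Const a \<in> ?P" for a by (intro subring_gen.gen) simp
  have e: "elem_sym n j \<in> ?P" for j
    unfolding elem_sym_def
    by (intro subring_gen_sum subring_gen_prod subring_gen.gen) auto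
  show ?thesis
    by (auto simp: eta_b_def eta_b'_def
        intro!: subring_gen_sum subring_gen_add subring_gen.mult subring_gen_numeral const[unfolded One_nat_def] e[unfolded One_nat_def])
qed

lemma poly_X_generated: "subring_gen (range Const \<union> Var ` {1..n}) \<subseteq> poly_X n"
proof
  fix f assume "f \<in> subring_gen (range Const \<union> Var ` {1..n} :: gamma mpoly set)"
  then show "f \<in> poly_X n" by induction (auto intro: poly_X_closed)
qed

theorem proposition14:
  fixes n :: nat
  assumes "n \<ge> 2"
  shows "eta_ring n = D_invariants n"
proof
  let ?S = "insert (eta_b' n) (eta_b n ` {1..})"
  have S: "?S \<subseteq> poly_X n" using eta_gens_poly_X poly_X_generated by blast
  have iff: "f \<in> D_invariants n \<longleftrightarrow> f \<in> poly_X n \<and> (\<forall>i<n. s_gen i f = f)" for f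
    unfolding D_invariants_iff[OF assms] s_gen_def using assms
    by (auto simp: Suc_le_eq dest: spec[of _ 0])
  show "eta_ring n \<subseteq> D_invariants n"
  proof
    fix f assume f: "f \<in> eta_ring n"
    then have "f \<in> poly_X n"
      unfolding eta_ring_def by induction (use S in \<open>auto intro: poly_X_closed\<close>)
    moreover have "f \<in> eta_ext n"
      using f unfolding eta_ring_def
      by (rule subring_gen_least) (auto simp: eta_ext_gens_def intro: subring_gen.gen)
    ultimately show "f \<in> D_invariants n"
      using assms by (auto simp: iff intro: eta_ext_invariant[of n])
  qed
  show "D_invariants n \<subseteq> eta_ring n"
  proof
    fix f assume "f \<in> D_invariants n"
    then have f: "f \<in> poly_X n" "\<And>i. i < n \<Longrightarrow> s_gen i f = f" by (auto simp: iff)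
    have "f \<in> eta_ext n" using assms f by (intro invariant_in_eta_ext) auto
    then have "drop_vars n f \<in> subring_gen (drop_vars n ` eta_ext_gens n)"
      by (rule ring_hom_subring_gen[OF is_ring_hom_drop_vars])
    moreover have "drop_vars n ` eta_ext_gens n \<subseteq> subring_gen ?S"
    proof -
      have "drop_vars n s \<in> subring_gen ?S" if "s \<in> ?S" for s
      proof -
        have "drop_vars n s = s" using that S by (intro drop_vars_poly_X) blast
        then show ?thesis using that by (simp only: subring_gen.gen)
      qed
      moreover have "drop_vars n (Var j) \<in> subring_gen ?S" if "j \<notin> {1..n}" for j
      proof -
        have "drop_vars n (Var j) = (if j \<in> {1..n} then Var j else 0)"
          unfolding drop_vars_def by (rule mpoly_eval_Var[OF is_ring_hom_Const])
        then show ?thesis using that by (simp only: if_False subring_gen_zero)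
      qed
      ultimately show ?thesis unfolding eta_ext_gens_def by blast
    qed
    ultimately show "f \<in> eta_ring n"
      using subring_gen_least drop_vars_poly_X[OF f(1)] unfolding eta_ring_def by metis
  qed
qed


end
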